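(* Let $\ell>q>1$, and let $K_0\le 0$ be the function $$K_0(x)=-\sum_{n=2}^\infty r_n^{-2}n^{-\ell}\,\eta_0\left(\frac{x-a_n}{r_n}\right),\quad x\in\mathbb{R}^2,$$ where $a_n=(n,0)\in\mathbb{R}^2$, $r_n=e^{-n^q}$ for $n\ge 2$, and $\eta_0$ is a smooth radial function on $\mathbb{R}^2$ with $\chi_{B_{1/2}}\le\eta_0\le\chi_{B_1}$. For $0<\alpha<\frac{\ell-1}{2}$ let $u_\alpha$ be the unique solution of $$\Delta u+K_0(x)e^{2u}=0\quad\text{in }\mathbb{R}^2$$ satisfying $$\int_{\mathbb{R}^2}K_0e^{2u}\,dx=-2\alpha\pi\quad\text{and}\quad\int_{\mathbb{R}^2\setminus B_1}\big|\nabla(u-\alpha\ln|x|)\big|^2dx<+\infty.$$ Set $\alpha_*=\frac{\ell-q}{2}$. Then: (i) For every $0<\alpha<\alpha_*$, there is $c_\alpha\in\mathbb{R}$ such that $u_\alpha(x)=\alpha\ln|x|+c_\alpha+o(1)$ as $|x|\to\infty$. (ii) For $\alpha=\alpha_*$, the solution $u_{\alpha_*}$ satisfies $u_{\alpha_*}(x)=\alpha_*\ln|x|+O(1)$ as $|x|\to\infty$, but $u_{\alpha_*}(x)-\alpha_*\ln|x|$ does not converge to any constant as $|x|\to\infty$. (iii) For every $\alpha_*<\alpha<\frac{\ell-1}{2}$, the function $u_\alpha(x)-\alpha\ln|x|$ is unbounded at infinity (that is, it is not $O(1)$ as $|x|\to\infty$).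
   Context: $B_r$ denotes the open ball of radius $r$ centered at the origin in $\mathbb{R}^2$, and $\chi_\Omega$ the characteristic function of $\Omega$. Solutions are continuous functions on $\mathbb{R}^2$ satisfying the equation in the sense of distributions. The existence and uniqueness of $u_\alpha$ is a known theorem of K.-S. Cheng and C.-S. Lin (Calc. Var. PDE 11 (2000)): if $K\le 0$ is locally bounded, not identically zero, and $\alpha_1(K):=\sup\{\alpha\in\mathbb{R}:\int_{\mathbb{R}^2}|K(x)|(1+|x|)^{2\alpha}dx<+\infty\}>0$, then for every $\alpha\in(0,\alpha_1(K))$ the equation $\Delta u+Ke^{2u}=0$ in $\mathbb{R}^2$ has a unique solution satisfying $\int_{\mathbb{R}^2}Ke^{2u}dx=-2\alpha\pi$ and $\int_{\mathbb{R}^2\setminus B_1}|\nabla(u-\alpha\ln|x|)|^2dx<+\infty$. For the function $K_0$ above, $\alpha_1(K_0)=\frac{\ell-1}{2}$. *)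

theory Defs
  imports "HOL-Analysis.Analysis" "HOL-Library.Landau_Symbols"
begin

definition pderivative :: "'a::euclidean_space \<Rightarrow> ('a \<Rightarrow> real) \<Rightarrow> 'a \<Rightarrow> real" where
  "pderivative v f = (\<lambda>x. frechet_derivative f (at x) v)"

primrec C_k :: "nat \<Rightarrow> ('a::euclidean_space \<Rightarrow> real) \<Rightarrow> bool" where
  "C_k 0 f \<longleftrightarrow> continuous_on UNIV f"
| "C_k (Suc k) f \<longleftrightarrow> (\<forall>x. f differentiable (at x)) \<and> (\<forall>v. C_k k (pderivative v f))"

definition C_infinity :: "('a::euclidean_space \<Rightarrow> real) \<Rightarrow> bool" where
  "C_infinity f \<longleftrightarrow> (\<forall>k. C_k k f)"

definition laplacian :: "('a::euclidean_space \<Rightarrow> real) \<Rightarrow> 'a \<Rightarrow> real" where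
  "laplacian f x = (\<Sum>b\<in>Basis. pderivative b (pderivative b f) x)"

definition test_function_on :: "'a::euclidean_space set \<Rightarrow> ('a \<Rightarrow> real) \<Rightarrow> bool" where
  "test_function_on S \<phi> \<longleftrightarrow> C_infinity \<phi> \<and>
     compact (closure {x. \<phi> x \<noteq> 0}) \<and> closure {x. \<phi> x \<noteq> 0} \<subseteq> S"

definition locally_integrable_on ::
    "('a::euclidean_space \<Rightarrow> 'b::euclidean_space) \<Rightarrow> 'a set \<Rightarrow> bool" where
  "locally_integrable_on f S \<longleftrightarrow>
     (\<forall>C. compact C \<and> C \<subseteq> S \<longrightarrow> f absolutely_integrable_on C)"

text \<open>Distributional gradient on an open set. The integrals below extend over the whole space:
  the test function and its derivatives vanish outside \<open>S\<close>, so the values of \<open>f\<close> and \<open>G\<close> there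
  are irrelevant.\<close>

definition weak_gradient_on ::
    "'a::euclidean_space set \<Rightarrow> ('a \<Rightarrow> real) \<Rightarrow> ('a \<Rightarrow> 'a) \<Rightarrow> bool" where
  "weak_gradient_on S f G \<longleftrightarrow>
     locally_integrable_on f S \<and> locally_integrable_on G S \<and>
     (\<forall>\<phi>. test_function_on S \<phi> \<longrightarrow>
       (\<forall>b\<in>Basis. (LINT x|lebesgue. f x * pderivative b \<phi> x)
                 = - (LINT x|lebesgue. (G x \<bullet> b) * \<phi> x)))"

text \<open>Continuous solutions of \<open>\<Delta>u + K e\<^sup>2\<^sup>u = 0\<close> on the whole space, in the sense of
  distributions.\<close>

definition liouville_solution ::
    "('a::euclidean_space \<Rightarrow> real) \<Rightarrow> ('a \<Rightarrow> real) \<Rightarrow> bool" where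
  "liouville_solution K u \<longleftrightarrow>
     continuous_on UNIV u \<and>
     locally_integrable_on (\<lambda>x. K x * exp (2 * u x)) UNIV \<and>
     (\<forall>\<phi>. test_function_on UNIV \<phi> \<longrightarrow>
       (LINT x|lebesgue. u x * laplacian \<phi> x + K x * exp (2 * u x) * \<phi> x) = 0)"

text \<open>The solutions in the Cheng--Lin existence and uniqueness theorem. The gradient of
  \<open>u - \<alpha> ln |x|\<close> is taken distributionally on the open exterior of the unit disc, which differs
  from the complement of the open disc only by a null set.\<close>

definition cheng_lin_solution ::
    "(real ^ 2 \<Rightarrow> real) \<Rightarrow> real \<Rightarrow> (real ^ 2 \<Rightarrow> real) \<Rightarrow> bool" where
  "cheng_lin_solution K \<alpha> u \<longleftrightarrow>
     liouville_solution K u \<and>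
     has_bochner_integral lebesgue (\<lambda>x. K x * exp (2 * u x)) (- 2 * \<alpha> * pi) \<and>
     (\<exists>G. weak_gradient_on (- cball 0 1) (\<lambda>x. u x - \<alpha> * ln (norm x)) G \<and>
          (\<lambda>x. (norm (G x))\<^sup>2) absolutely_integrable_on (- ball 0 1))"

definition bump_center :: "nat \<Rightarrow> real ^ 2" where
  "bump_center n = vector [real n, 0]"

definition bump_radius :: "real \<Rightarrow> nat \<Rightarrow> real" where
  "bump_radius q n = exp (- (real n powr q))"

definition K\<^sub>0 :: "(real ^ 2 \<Rightarrow> real) \<Rightarrow> real \<Rightarrow> real \<Rightarrow> real ^ 2 \<Rightarrow> real" where
  "K\<^sub>0 \<eta>\<^sub>0 l q x =
     - (\<Sum>\<^sub>\<infinity>n\<in>{2..}. bump_radius q n powr (-2) * real n powr (- l) *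
                      \<eta>\<^sub>0 ((x - bump_center n) /\<^sub>R bump_radius q n))"

definition radial :: "('a::real_normed_vector \<Rightarrow> real) \<Rightarrow> bool" where
  "radial f \<longleftrightarrow> (\<forall>x y. norm x = norm y \<longrightarrow> f x = f y)"

end

theory Submission
  imports Defs "HOL-Real_Asymp.Real_Asymp"
begin

text \<open>Write \<open>f = - K\<^sub>0 e\<^sup>2\<^sup>u\<close>, so that \<open>\<Delta>u = f\<close> and \<open>f\<close> has mass \<open>2\<pi>\<alpha>\<close>. Testing the equation with
  smoothly truncated fundamental solutions, and using the finite energy of \<open>u - \<alpha> ln |x|\<close> to show
  that averages of \<open>u\<close> over large annuli around two points differ by \<open>o(1)\<close>, gives \<open>u x - u z =
  (1/2\<pi>) \<integral> (ln |y - x| - ln |y - z|) f(y) dy\<close>. Hence \<open>u \<le> \<alpha> ln (1 + |x|) + O(1)\<close>, the mass of \<open>f\<close>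
  on the \<open>n\<close>-th bump is at most of order \<open>n\<close> to the power \<open>2\<alpha> - l\<close>, the function \<open>f ln |y|\<close> is
  integrable, and \<open>u - \<alpha> ln |x|\<close> equals a constant plus \<open>o(1)\<close> minus the near potential \<open>(1/2\<pi>) \<integral>
  ln\<^sup>+ (1 / |y - x|) f(y) dy\<close>. Since \<open>ln (1 / r\<^sub>n)\<close> is \<open>n\<close> to the power \<open>q\<close>, the near potential is
  of order at most \<open>q + 2\<alpha> - l\<close> in \<open>n\<close>, attained at the bump centers as soon as \<open>u - \<alpha> ln |x|\<close> is
  bounded below, and it vanishes on the negative axis.\<close>

subsection \<open>Calculus of iterated directional derivatives\<close>

text \<open>Solutions are only continuous, so all information enters through test functions, which
  have to be smooth at their centre. Radial objects are therefore functions of the squared distance,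
  and the logarithm enters as a difference of two truncations whose singularities cancel. The small
  scale tends to 0 and recovers the value of \<open>u\<close>; the large scale leaves an average
  over an annulus. For given \<open>f\<close> the equation fixes \<open>u\<close> only up to a
  harmonic function, and the finite energy is what excludes this freedom. The estimates of
  \<open>f\<close> involve \<open>u\<close>, yet there is no circularity: the upper bound for
  \<open>u\<close> uses only the total mass. A lower bound for \<open>f\<close> on the bumps needs
  \<open>u\<close> bounded below by the logarithm; at the critical exponent this follows from the
  upper bound on the near potential, above it from the assumption to be refuted. The cutoff in the
  truncations is the given profile restricted to a line. It may oscillate between 0 and 1, so the
  averaging kernels may change sign and are controlled through their absolute values.\<close>

lemma pderivative_eqI:
  assumes "\<And>x. (f has_derivative D x) (at x)"
  shows "pderivative v f = (\<lambda>x. D x v)"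
  unfolding pderivative_def using frechet_derivative_at[OF assms] by (metis (full_types))

lemma C_k_0D: "C_k k f \<Longrightarrow> continuous_on UNIV f"
  by (cases k) (auto simp: continuous_on_eq_continuous_at differentiable_imp_continuous_within)

lemma C_k_SucD: "C_k (Suc k) f \<Longrightarrow> C_k k f"
  by (induction k arbitrary: f)
     (auto simp: continuous_on_eq_continuous_at differentiable_imp_continuous_within)

lemma C_k_has_derivative:
  "C_k (Suc k) f \<Longrightarrow> (f has_derivative (\<lambda>v. pderivative v f x)) (at x)"
  unfolding pderivative_def by (simp add: frechet_derivative_works[symmetric] eta_contract_eq)

lemma C_k_SucI:
  assumes "\<And>x. (f has_derivative D x) (at x)" and "\<And>v. C_k k (\<lambda>x. D x v)"
  shows "C_k (Suc k) f"
  using assms pderivative_eqI[OF assms(1)] by (auto simp: differentiable_def)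

lemma C_k_const: "C_k k (\<lambda>x. c)"
proof (induction k arbitrary: c)
  case (Suc k)
  show ?case by (rule C_k_SucI[where D="\<lambda>x v. 0"]) (auto intro: Suc)
qed auto

lemma C_k_add: "C_k k f \<Longrightarrow> C_k k g \<Longrightarrow> C_k k (\<lambda>x. f x + g x)"
proof (induction k arbitrary: f g)
  case (Suc k)
  show ?case
  proof (rule C_k_SucI)
    show "((\<lambda>x. f x + g x) has_derivative (\<lambda>v. pderivative v f x + pderivative v g x)) (at x)" for x
      using Suc.prems by (intro has_derivative_add C_k_has_derivative)
    show "C_k k (\<lambda>x. pderivative v f x + pderivative v g x)" for v
      using Suc by simp
  qed
qed (auto intro: continuous_intros)

lemma C_k_mult: "C_k k f \<Longrightarrow> C_k k g \<Longrightarrow> C_k k (\<lambda>x. f x * g x)"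
proof (induction k arbitrary: f g)
  case (Suc k)
  show ?case
  proof (rule C_k_SucI)
    show "((\<lambda>x. f x * g x) has_derivative (\<lambda>v. f x * pderivative v g x + pderivative v f x * g x))
        (at x)"
      for x
      using Suc.prems by (intro has_derivative_mult C_k_has_derivative)
    show "C_k k (\<lambda>x. f x * pderivative v g x + pderivative v f x * g x)" for v
      using Suc C_k_SucD by (intro C_k_add Suc.IH) auto
  qed
qed (auto intro: continuous_intros)

lemma C_k_cmult: "C_k k f \<Longrightarrow> C_k k (\<lambda>x. c * f x)"
  by (intro C_k_mult C_k_const)

lemma C_k_inner_affine: "C_k k (\<lambda>x. (x - a) \<bullet> v)"
proof (cases k)
  case (Suc k)
  show ?thesis unfolding Suc
    by (rule C_k_SucI[where D="\<lambda>x w. w \<bullet> v"]) (auto intro!: derivative_eq_intros C_k_const)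
qed (auto intro!: continuous_intros)

lemma has_derivative_compose_dist_sq:
  fixes g :: "real \<Rightarrow> real"
  assumes "(g has_real_derivative g') (at ((x - a) \<bullet> (x - a)))"
  shows "((\<lambda>x. g ((x - a) \<bullet> (x - a))) has_derivative (\<lambda>v. 2 * ((x - a) \<bullet> v) * g')) (at x)"
proof -
  have "((\<lambda>x. (x - a) \<bullet> (x - a)) has_derivative (\<lambda>v. 2 * ((x - a) \<bullet> v))) (at x)"
    by (auto intro!: derivative_eq_intros simp: inner_commute)
  from has_derivative_compose[OF this assms[unfolded has_field_derivative_def]]
  show ?thesis by (simp add: mult.commute)
qed

lemma C_k_SucD_real:
  fixes f :: "real \<Rightarrow> real"
  assumes "C_k (Suc k) f"
  shows "(f has_real_derivative pderivative 1 f x) (at x)" and "C_k k (pderivative 1 f)"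
proof -
  have d: "(f has_derivative (\<lambda>v. pderivative v f x)) (at x)"
    by (rule C_k_has_derivative[OF assms])
  have "(\<lambda>v. pderivative v f x) = (*) (pderivative 1 f x)"
  proof
    fix v :: real
    show "pderivative v f x = pderivative 1 f x * v"
      using linear_cmul[OF has_derivative_linear[OF d], of v 1] by (simp del: One_nat_def)
  qed
  with d show "(f has_real_derivative pderivative 1 f x) (at x)"
    by (simp add: has_field_derivative_def)
  show "C_k k (pderivative 1 f)" using assms by simp
qed

lemma C_k_SucI_real:
  fixes f :: "real \<Rightarrow> real"
  assumes "\<And>x. (f has_real_derivative f' x) (at x)" and "C_k k f'"
  shows "C_k (Suc k) f"
  by (rule C_k_SucI[where D="\<lambda>x v. v * f' x"])
     (use assms in \<open>auto simp: has_field_derivative_def mult.commute[of _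
         "f' _"] intro!: C_k_mult C_k_const\<close>)

text \<open>The squared distance is a polynomial, so the centre \<open>a\<close> needs no special
  treatment. The induction closes because a directional derivative is again such a composition times
  an affine factor.\<close>

lemma C_k_compose_dist_sq:
  fixes g :: "real \<Rightarrow> real"
  assumes "C_k k g"
  shows "C_k k (\<lambda>x. g ((x - a) \<bullet> (x - a)))"
  using assms
proof (induction k arbitrary: g)
  case 0
  then show ?case
    by (auto intro!: continuous_on_compose2[of UNIV g] continuous_intros)
next
  case (Suc k)
  show ?case
  proof (rule C_k_SucI)
    show "((\<lambda>x. g ((x - a) \<bullet> (x - a))) has_derivative
        (\<lambda>v. 2 * ((x - a) \<bullet> v) * pderivative 1 g ((x - a) \<bullet> (x - a)))) (at x)" for x
      by (rule has_derivative_compose_dist_sq, rule C_k_SucD_real[OF Suc.prems])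
    show "C_k k (\<lambda>x. 2 * ((x - a) \<bullet> v) * pderivative 1 g ((x - a) \<bullet> (x - a)))" for v
      using Suc.IH[OF C_k_SucD_real(2)[OF Suc.prems]]
      by (intro C_k_mult C_k_const C_k_inner_affine)
  qed
qed

lemma C_k_compose_scale:
  fixes g :: "real \<Rightarrow> real"
  assumes "C_k k g"
  shows "C_k k (\<lambda>x. g (x * c))"
  using assms
proof (induction k arbitrary: g)
  case 0
  then show ?case
    by (auto intro!: continuous_on_compose2[of UNIV g] continuous_intros)
next
  case (Suc k)
  show ?case
  proof (rule C_k_SucI_real)
    show "((\<lambda>x. g (x * c)) has_real_derivative pderivative 1 g (x * c) * c) (at x)" for x
      by (rule DERIV_chain2[OF C_k_SucD_real(1)[OF Suc.prems]]) (auto intro!: derivative_eq_intros)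
    show "C_k k (\<lambda>x. pderivative 1 g (x * c) * c)"
      using Suc.IH[OF C_k_SucD_real(2)[OF Suc.prems]] by (intro C_k_mult C_k_const)
  qed
qed

text \<open>Differentiating the quotient raises the power of the denominator, so the induction runs
  over all \<open>j\<close> at once. Near 0 the numerator and its derivative vanish identically,
  hence so does the quotient.\<close>

lemma C_k_divide_power:
  fixes h :: "real \<Rightarrow> real"
  assumes "C_k k h" and "e > 0" and "\<And>s. \<bar>s\<bar> < e \<Longrightarrow> h s = 0"
  shows "C_k k (\<lambda>s. h s / s ^ j)"
  using assms(1,3)
proof (induction k arbitrary: h j)
  case 0
  have "isCont (\<lambda>s. h s / s ^ j) s" for s
  proof (cases "\<bar>s\<bar> < e")
    case True
    then have "\<forall>\<^sub>F t in nhds s. h t / t ^ j = 0"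
      using 0 by (auto simp: eventually_nhds intro!: exI[of _ "{-e<..<e}"])
    then show ?thesis by (subst isCont_cong[where g="\<lambda>_. 0"]) auto
  next
    case False
    with 0 assms(2) show ?thesis
      by (auto simp: continuous_on_eq_continuous_at intro!: continuous_intros)
  qed
  then show ?case by (simp add: continuous_on_eq_continuous_at)
next
  case (Suc k)
  note h' = C_k_SucD_real[OF Suc.prems(1)]
  have zero: "pderivative 1 h s = 0" if "\<bar>s\<bar> < e" for s
  proof -
    have "(h has_real_derivative 0) (at s)"
      using DERIV_const by (rule has_field_derivative_transform_within_open[where S="{-e<..<e}"
          and f="\<lambda>_. 0"])
        (use that Suc.prems in auto)
    with h'(1) show ?thesis by (rule DERIV_unique)
  qed
  show ?case
  proof (rule C_k_SucI_real)
    show "((\<lambda>s. h s / s ^ j) has_real_derivative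
        pderivative 1 h s / s ^ j + (- real j) * (h s / s ^ Suc j)) (at s)" for s
    proof (cases "\<bar>s\<bar> < e")
      case True
      have "((\<lambda>s. h s / s ^ j) has_real_derivative 0) (at s)"
        using DERIV_const by (rule has_field_derivative_transform_within_open[where S="{-e<..<e}"
            and f="\<lambda>_. 0"])
          (use True Suc.prems in auto)
      with True zero Suc.prems show ?thesis by simp
    next
      case False
      then have "s \<noteq> 0" using assms by auto
      \<comment> \<open>For \<open>j = 0\<close> the truncated subtraction is harmless: the factor
        \<open>real j\<close> kills both sides.\<close>
      have j: "real j * s ^ (j - 1) = real j * s ^ j / s"
        using \<open>s \<noteq> 0\<close> by (cases j) auto
      have "((\<lambda>s. h s / s ^ j) has_real_derivative
          (pderivative 1 h s * s ^ j - h s * (real j * s ^ (j - 1))) / (s ^ j * s ^ j)) (at s)"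
        using \<open>s \<noteq> 0\<close> by (auto intro!: derivative_eq_intros h')
      also have "(pderivative 1 h s * s ^ j - h s * (real j * s ^ (j - 1))) / (s ^ j * s ^ j) =
          pderivative 1 h s / s ^ j + (- real j) * (h s / s ^ Suc j)"
        unfolding j using \<open>s \<noteq> 0\<close> by (simp add: field_simps)
      finally show ?thesis .
    qed
    show "C_k k (\<lambda>s. pderivative 1 h s / s ^ j + (- real j) * (h s / s ^ Suc j))"
      by (intro C_k_add C_k_cmult Suc.IH h' zero C_k_SucD[OF Suc.prems(1)] Suc.prems(2))
  qed
qed

text \<open>Serves to turn the planar profile into a smooth cutoff of one real variable.\<close>

lemma C_k_along_line:
  fixes f :: "'a::euclidean_space \<Rightarrow> real"
  assumes "C_k k f"
  shows "C_k k (\<lambda>t::real. f (t *\<^sub>R e))"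
  using assms
proof (induction k arbitrary: f)
  case 0
  then show ?case
    by (auto intro!: continuous_on_compose2[of UNIV f] continuous_intros)
next
  case (Suc k)
  show ?case
  proof (rule C_k_SucI_real)
    fix t :: real
    have d: "((\<lambda>t. t *\<^sub>R e) has_derivative (\<lambda>h. h *\<^sub>R e)) (at t)"
      by (auto intro!: derivative_eq_intros)
    have f: "(f has_derivative (\<lambda>v. pderivative v f (t *\<^sub>R e))) (at (t *\<^sub>R e))"
      by (rule C_k_has_derivative[OF Suc.prems])
    have "(\<lambda>h. pderivative (h *\<^sub>R e) f (t *\<^sub>R e)) = (*) (pderivative e f (t *\<^sub>R e))"
    proof
      fix h :: real
      show "pderivative (h *\<^sub>R e) f (t *\<^sub>R e) = pderivative e f (t *\<^sub>R e) * h"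
        using linear_cmul[OF has_derivative_linear[OF f], of h e] by simp
    qed
    with has_derivative_compose[OF d f]
    show "((\<lambda>t. f (t *\<^sub>R e)) has_real_derivative pderivative e f (t *\<^sub>R e)) (at t)"
      by (simp add: has_field_derivative_def)
    show "C_k k (\<lambda>t. pderivative e f (t *\<^sub>R e))"
      using Suc by simp
  qed
qed

lemma laplacian_compose_dist_sq:
  fixes g g' g'' :: "real \<Rightarrow> real" and a :: "'a::euclidean_space"
  assumes "\<And>s. (g has_real_derivative g' s) (at s)" and "\<And>s. (g' has_real_derivative g'' s) (at s)"
  defines "N \<equiv> \<lambda>x::'a. (x - a) \<bullet> (x - a)"
  shows "laplacian (\<lambda>x. g (N x)) x = 2 * real DIM('a) * g' (N x) + 4 * N x * g'' (N x)"
proof -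
  have 1: "pderivative b (\<lambda>x. g (N x)) = (\<lambda>x. 2 * ((x - a) \<bullet> b) * g' (N x))" for b
    unfolding N_def by (rule pderivative_eqI, rule has_derivative_compose_dist_sq, rule assms)
  have 2: "pderivative b (\<lambda>x. 2 * ((x - a) \<bullet> b) * g' (N x)) =
     (\<lambda>x. 2 * ((x - a) \<bullet> b) * (2 * ((x - a) \<bullet> b) * g'' (N x)) + 2 * (b \<bullet> b) * g' (N x))" for b
    unfolding N_def
    by (rule pderivative_eqI, rule has_derivative_mult[OF _ has_derivative_compose_dist_sq[OF
        assms(2)]])
       (auto intro!: derivative_eq_intros)
  have "laplacian (\<lambda>x. g (N x)) x =
     (\<Sum>b\<in>Basis. 2 * ((x - a) \<bullet> b) * (2 * ((x - a) \<bullet> b) * g'' (N x)) + 2 * (b \<bullet> b) * g' (N x))"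
    unfolding laplacian_def 1 2 ..
  also have "\<dots> = (\<Sum>b\<in>Basis. 4 * g'' (N x) * (((x - a) \<bullet> b) * ((x - a) \<bullet> b)) + 2 * g' (N x))"
    by (rule sum.cong) (auto simp: algebra_simps)
  also have "\<dots> = 4 * g'' (N x) * N x + 2 * real DIM('a) * g' (N x)"
    unfolding N_def by (subst euclidean_inner[of "x - a" "x - a"])
       (simp add: sum.distrib sum_distrib_left)
  finally show ?thesis by simp
qed

text \<open>The closure of the nonvanishing set must lie in \<open>S\<close>, which may be open; the
  closed set \<open>T\<close> squeezed in between guarantees this.\<close>

lemma test_functionI_dist_sq:
  fixes g :: "real \<Rightarrow> real"
  assumes "\<And>k. C_k k g" and "\<And>s. s \<ge> b \<Longrightarrow> g s = 0"
    and "\<And>x. g ((x - a) \<bullet> (x - a)) \<noteq> 0 \<Longrightarrow> x \<in> T" and "closed T" and "T \<subseteq> S"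
  shows "test_function_on S (\<lambda>x. g ((x - a) \<bullet> (x - a)))"
proof -
  let ?A = "{x. g ((x - a) \<bullet> (x - a)) \<noteq> 0}"
  have "?A \<subseteq> cball a (sqrt \<bar>b\<bar>)"
  proof
    fix x assume "x \<in> ?A"
    then have "(x - a) \<bullet> (x - a) \<le> \<bar>b\<bar>"
      using assms(2)[of "(x - a) \<bullet> (x - a)"] by fastforce
    then show "x \<in> cball a (sqrt \<bar>b\<bar>)"
      by (subst mem_cball, subst dist_commute) (simp add: dist_norm norm_eq_sqrt_inner)
  qed
  then have "compact (closure ?A)"
    using bounded_subset bounded_cball compact_closure by blast
  moreover have "closure ?A \<subseteq> S"
    using assms(3-5) closure_minimal[of ?A T] by blast
  ultimately show ?thesis
    using assms(1) by (auto simp: test_function_on_def C_infinity_def intro!: C_k_compose_dist_sq)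
qed

subsection \<open>Radial integrals in the plane\<close>

text \<open>Replaces polar coordinates: the disc of squared radius \<open>s\<close> has area
  \<open>pi * s\<close>, linear in \<open>s\<close>, so the squared distance has constant density
  \<open>pi\<close> on the half-line. Half-lines generate the Borel sets and suffice for the
  comparison.\<close>

lemma distr_dist_sq_lborel:
  fixes a :: "real ^ 2"
  shows "distr lborel borel (\<lambda>x. (x - a) \<bullet> (x - a)) =
      density lborel (\<lambda>s. ennreal pi * indicator {0..} s)"
    (is "?M = ?N")
proof (rule measure_eqI_generator_eq[where E="range atMost" and \<Omega>=UNIV and A="\<lambda>n. {..real n}"])
  have M: "emeasure ?M {..s} = ennreal (pi * max 0 s)" for s :: real
  proof (cases "s \<ge> 0")
    case True
    then have "(\<lambda>x. (x - a) \<bullet> (x - a)) -` {..s} = cball a (sqrt s)"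
      by (auto simp: dist_norm norm_eq_sqrt_inner inner_diff inner_commute)
    then show ?thesis
      using True by (simp add: emeasure_distr emeasure_cball unit_ball_vol_2)
  next
    case False
    have "s < (x - a) \<bullet> (x - a)" for x
      using False inner_ge_zero[of "x - a"] by linarith
    then have "(\<lambda>x. (x - a) \<bullet> (x - a)) -` {..s} = {}"
      by (auto simp: not_le[symmetric])
    then show ?thesis using False by (simp add: emeasure_distr)
  qed
  have N: "emeasure ?N {..s} = ennreal (pi * max 0 s)" for s :: real
  proof -
    have "emeasure ?N {..s} = (\<integral>\<^sup>+x. ennreal pi * indicator {0..s} x \<partial>lborel)"
      by (subst emeasure_density) (auto intro!: nn_integral_cong split: split_indicator)
    also have "\<dots> = ennreal (pi * max 0 s)"
      by (subst nn_integral_cmult_indicator) (auto simp: ennreal_mult' max_def)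
    finally show ?thesis .
  qed
  show "emeasure ?M X = emeasure ?N X" if "X \<in> range atMost" for X
    using that M N by auto
  show "Int_stable (range (atMost :: real \<Rightarrow> real set))"
    by (auto simp: Int_stable_def)
  show "sets ?M = sigma_sets UNIV (range atMost)" "sets ?N = sigma_sets UNIV (range atMost)"
    by (simp_all add: borel_eq_atMost)
  show "(\<Union>i. {..real i}) = UNIV"
    using real_arch_simple by auto
  show "emeasure ?M {..real i} \<noteq> \<infinity>" for i by (simp add: M)
qed auto

lemma nn_integral_dist_sq:
  fixes a :: "real ^ 2"
  assumes [measurable]: "F \<in> borel_measurable borel"
  shows "(\<integral>\<^sup>+x. F ((x - a) \<bullet> (x - a)) \<partial>lborel) = pi * (\<integral>\<^sup>+s. F s * indicator {0..} s \<partial>lborel)"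
proof -
  have "(\<integral>\<^sup>+x. F ((x - a) \<bullet> (x - a)) \<partial>lborel) =
      (\<integral>\<^sup>+s. F s \<partial>distr lborel borel (\<lambda>x. (x - a) \<bullet> (x - a)))"
    by (subst nn_integral_distr) auto
  also have "\<dots> = (\<integral>\<^sup>+s. pi * (F s * indicator {0..} s) \<partial>lborel)"
    unfolding distr_dist_sq_lborel by (subst nn_integral_density) (auto simp: mult_ac)
  also have "\<dots> = pi * (\<integral>\<^sup>+s. F s * indicator {0..} s \<partial>lborel)"
    by (rule nn_integral_cmult) auto
  finally show ?thesis .
qed

lemma integral_dist_sq:
  fixes a :: "real ^ 2" and F :: "real \<Rightarrow> real"
  assumes [measurable]: "F \<in> borel_measurable borel"
  shows "(LINT x|lborel. F ((x - a) \<bullet> (x - a))) = pi * (LINT s:{0..}|lborel. F s)"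
proof -
  have "(LINT x|lborel. F ((x - a) \<bullet> (x - a))) =
      integral\<^sup>L (distr lborel borel (\<lambda>x. (x - a) \<bullet> (x - a))) F"
    by (subst integral_distr) auto
  also have "\<dots> = integral\<^sup>L (density lborel (\<lambda>s. ennreal (pi * indicator {0..} s))) F"
    unfolding distr_dist_sq_lborel
    by (intro arg_cong2[where f="integral\<^sup>L"] arg_cong2[where f=density])
       (auto split: split_indicator)
  also have "\<dots> = (LINT s|lborel. (pi * indicator {0..} s) *\<^sub>R F s)"
    by (rule integral_density) auto
  also have "\<dots> = pi * (LINT s:{0..}|lborel. F s)"
    unfolding set_lebesgue_integral_def
    by (subst integral_mult_right_zero[symmetric]) (simp add: mult_ac)
  finally show ?thesis .
qed

text \<open>The crude estimate \<open>ln t \<le> t\<close> suffices: the integral of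
  \<open>r / norm (x - a)\<close> over the disc of radius \<open>r\<close> is exactly the right-hand
  side. The scaling with \<open>r\<^sup>2\<close> matters later, where it cancels the factor
  \<open>r\<^sub>n\<close> to the power -2 in the height of a bump.\<close>

lemma nn_integral_ln_pos:
  fixes a :: "real ^ 2" and r :: real
  assumes "r > 0"
  shows "(\<integral>\<^sup>+x. ennreal (max 0 (ln (r / norm (x - a)))) \<partial>lborel) \<le> ennreal (2 * pi * r\<^sup>2)"
proof -
  define F where "F s = ennreal (r * s powr (-1/2) * indicator {0..r\<^sup>2} s)" for s
  have [measurable]: "F \<in> borel_measurable borel" unfolding F_def by measurable
  have "(\<integral>\<^sup>+x. ennreal (max 0 (ln (r / norm (x - a)))) \<partial>lborel) \<le>
     (\<integral>\<^sup>+x. F ((x - a) \<bullet> (x - a)) \<partial>lborel)"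
  proof (rule nn_integral_mono)
    fix x
    \<comment> \<open>At \<open>x = a\<close> division by zero and \<open>ln 0\<close> both give 0,
      so the left side vanishes there.\<close>
    consider "x = a" | "norm (x - a) > r" | "x \<noteq> a" "norm (x - a) \<le> r" by linarith
    then show "ennreal (max 0 (ln (r / norm (x - a)))) \<le> F ((x - a) \<bullet> (x - a))"
    proof cases
      case 2
      then have "ln (r / norm (x - a)) \<le> 0"
        using assms by (intro ln_le_zero_iff[THEN iffD2] divide_pos_pos divide_le_eq_1_pos[THEN
            iffD2]) auto
      then show ?thesis by (simp add: max_absorb1)
    next
      case 3
      have "ln (r / norm (x - a)) \<le> r / norm (x - a)"
        using 3 assms by (intro order_trans[OF ln_le_minus_one]) auto
      moreover have "((x - a) \<bullet> (x - a)) powr (-1/2) = 1 / norm (x - a)"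
        by (simp add: dot_square_norm powr_minus powr_half_sqrt inverse_eq_divide)
      ultimately show ?thesis
        using 3 assms by (auto simp: F_def dot_square_norm power_mono intro!: ennreal_leI)
    qed simp
  qed
  also have "\<dots> = pi * (\<integral>\<^sup>+s. F s * indicator {0..} s \<partial>lborel)"
    by (rule nn_integral_dist_sq) auto
  also have "(\<integral>\<^sup>+s. F s * indicator {0..} s \<partial>lborel) =
      (\<integral>\<^sup>+s. ennreal (r * s powr (-1/2)) * indicator {0..r\<^sup>2} s \<partial>lborel)"
    by (rule nn_integral_cong) (auto simp: F_def split: split_indicator)
  also have "\<dots> = ennreal (r * (r\<^sup>2 powr (-1/2 + 1) / (-1/2 + 1)))"
    using has_integral_mult_right[OF has_integral_powr_from_0[of "-1/2" "r\<^sup>2"], of r] assms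
    by (subst nn_integral_has_integral_lebesgue') auto
  also have "r * (r\<^sup>2 powr (-1/2 + 1) / (-1/2 + 1)) = 2 * r\<^sup>2"
    using assms by (simp add: powr_half_sqrt power2_eq_square)
  finally show ?thesis by (simp add: ennreal_mult'[symmetric] mult_ac)
qed

subsection \<open>Truncated fundamental solutions\<close>

text \<open>Arguments will be squared distances, so the shape of the cutoff matters on the
  nonnegative half-line only. The plateau is two-sided around 0 so that derivatives vanish in a full
  neighbourhood of 0.\<close>

locale plane_cutoff =
  fixes \<theta> :: "real \<Rightarrow> real"
  assumes smooth: "C_k k \<theta>"
    and eq_one: "\<bar>s\<bar> < 1/2 \<Longrightarrow> \<theta> s = 1"
    and eq_zero: "1 \<le> s \<Longrightarrow> \<theta> s = 0"
    and nonneg: "0 \<le> \<theta> s"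
    and le_one: "\<theta> s \<le> 1"
begin

abbreviation d\<theta> :: "real \<Rightarrow> real" where "d\<theta> \<equiv> pderivative 1 \<theta>"

lemma has_derivative_\<theta>: "(\<theta> has_real_derivative d\<theta> s) (at s)"
  by (rule C_k_SucD_real[OF smooth])

lemma C_k_d\<theta>: "C_k k d\<theta>"
  by (rule C_k_SucD_real[OF smooth])

lemma isCont_\<theta>: "isCont \<theta> s"
  using C_k_0D[OF smooth[of 0]] by (simp add: continuous_on_eq_continuous_at)

lemma isCont_d\<theta>: "isCont d\<theta> s"
  using C_k_0D[OF C_k_d\<theta>[of 0]] by (simp add: continuous_on_eq_continuous_at)

text \<open>Where the cutoff equals 1 it has a global maximum, where it equals 0 a global minimum.
  This covers the end point \<open>s = 1\<close>, at which local constancy is known on one side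
  only.\<close>

lemma d\<theta>_eq_0: assumes "\<bar>s\<bar> < 1/2 \<or> 1 \<le> s" shows "d\<theta> s = 0"
  using assms
proof
  assume s: "\<bar>s\<bar> < 1/2"
  have "\<And>y. \<theta> y \<le> \<theta> s" using s le_one eq_one by simp
  then show ?thesis using DERIV_local_max[OF has_derivative_\<theta>, of 1 s] by auto
next
  assume s: "1 \<le> s"
  have "\<And>y. \<theta> s \<le> \<theta> y" using s nonneg eq_zero by simp
  then show ?thesis using DERIV_local_min[OF has_derivative_\<theta>, of 1 s] by auto
qed

lemma d\<theta>_bounded: "\<exists>M>0. \<forall>s\<ge>0. \<bar>d\<theta> s\<bar> \<le> M"
proof -
  have "compact (d\<theta> ` {0..1})"
    by (intro compact_continuous_image) (auto intro: continuous_at_imp_continuous_on isCont_d\<theta>)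
  then have "bounded (d\<theta> ` {0..1})" by (rule compact_imp_bounded)
  then obtain M where M: "M > 0" "\<And>s. s \<in> {0..1} \<Longrightarrow> \<bar>d\<theta> s\<bar> \<le> M"
    unfolding bounded_pos by auto
  have "\<bar>d\<theta> s\<bar> \<le> M" if "s \<ge> 0" for s
    using M that d\<theta>_eq_0[of s] by (cases "s \<le> 1") auto
  with M(1) show ?thesis by blast
qed

text \<open>In the plane \<open>\<Delta> (g (|x|\<^sup>2)) = 4 (s g'(s))'\<close> at \<open>s = |x|\<^sup>2\<close>. So \<open>L (|x|\<^sup>2)\<close> agrees near the
  origin with \<open>ln |x| / (2\<pi>)\<close> up to a constant, and its Laplacian away from the origin is \<open>- \<rho> 1
  (|x|\<^sup>2)\<close> with the unit mass profile \<open>\<rho>\<close> below.\<close>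

definition L :: "real \<Rightarrow> real" where
  "L = (SOME L. (\<forall>s>0. (L has_real_derivative \<theta> s / (4 * pi * s)) (at s)) \<and> L 1 =
      0 \<and> (\<forall>s\<le>0. L s = 0))"

text \<open>The integrand is singular at 0, so the antiderivative is taken on the open half-line and
  normalised at 1. The value 0 on the rest of the line is a convention. The factor
  \<open>4 * pi\<close> becomes \<open>2 * pi\<close> once \<open>s\<close> is a squared
  distance.\<close>

lemma L_props: "(\<forall>s>0. (L has_real_derivative \<theta> s / (4 * pi * s)) (at s)) \<and> L 1 =
    0 \<and> (\<forall>s\<le>0. L s = 0)"
proof -
  have "\<exists>F. \<forall>s. ereal 0 < s \<longrightarrow> s < \<infinity> \<longrightarrow> (F has_vector_derivative \<theta> s / (4 * pi * s)) (at s)"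
    by (rule einterval_antiderivative) (auto intro!: continuous_intros isCont_\<theta>)
  then obtain F where F: "\<And>s. s > 0 \<Longrightarrow> (F has_real_derivative \<theta> s / (4 * pi * s)) (at s)"
    by (auto simp: has_real_derivative_iff_has_vector_derivative)
  show ?thesis unfolding L_def
  proof (rule someI[where x="\<lambda>s. if s \<le> 0 then 0 else F s - F 1"], intro conjI allI impI)
    fix s :: real assume s: "0 < s"
    have "((\<lambda>s. F s - F 1) has_real_derivative \<theta> s / (4 * pi * s)) (at s)"
      using s by (auto intro!: derivative_eq_intros F)
    then show "((\<lambda>s. if s \<le> 0 then 0 else F s - F 1) has_real_derivative \<theta> s / (4 * pi * s)) (at s)"
      by (rule has_field_derivative_transform_within_open[where S="{0<..}"]) (use s in auto)
  qed auto
qed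

lemma L_deriv: "s > 0 \<Longrightarrow> (L has_real_derivative \<theta> s / (4 * pi * s)) (at s)"
  and L_1: "L 1 = 0" and L_le_0: "s \<le> 0 \<Longrightarrow> L s = 0"
  using L_props by auto

lemma L_mono: assumes "0 < s" "s \<le> t" shows "L s \<le> L t"
proof (rule DERIV_nonneg_imp_nondecreasing[OF assms(2)])
  fix x assume "s \<le> x"
  then have "x > 0" using assms by auto
  then show "\<exists>y. DERIV L x :> y \<and> 0 \<le> y"
    using L_deriv[of x] nonneg[of x] by (intro exI[of _ "\<theta> x / (4 * pi * x)"]) auto
qed

text \<open>Since the cutoff is at most 1, \<open>L\<close> grows no faster than the pure logarithm.
  This supplies the integrable majorants for dominated convergence, while equality for small
  arguments identifies the limits.\<close>

lemma L_diff_le: assumes "0 < s" "s \<le> t" shows "L t - L s \<le> (ln t - ln s) / (4 * pi)"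
proof -
  have "ln s / (4 * pi) - L s \<le> ln t / (4 * pi) - L t"
  proof (rule DERIV_nonneg_imp_nondecreasing[OF assms(2)])
    fix x assume "s \<le> x"
    then have x: "x > 0" using assms by auto
    have "((\<lambda>x. ln x / (4 * pi) - L x) has_real_derivative (1 - \<theta> x) / (4 * pi * x)) (at x)"
      using x by (auto intro!: derivative_eq_intros L_deriv simp: field_simps)
    moreover have "(1 - \<theta> x) / (4 * pi * x) \<ge> 0"
      using x le_one[of x] by auto
    ultimately show "\<exists>y. DERIV (\<lambda>x. ln x / (4 * pi) - L x) x :> y \<and> 0 \<le> y" by blast
  qed
  then show ?thesis by (simp add: diff_divide_distrib)
qed

lemma L_diff_small: assumes "0 < s" "s \<le> t" "t < 1/2" shows "L t - L s = (ln t - ln s) / (4 * pi)"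
proof -
  have "ln t / (4 * pi) - L t \<le> ln s / (4 * pi) - L s"
  proof (rule DERIV_nonpos_imp_nonincreasing[OF assms(2)])
    fix x assume "s \<le> x" "x \<le> t"
    then have x: "x > 0" "\<bar>x\<bar> < 1/2" using assms by auto
    have "((\<lambda>x. ln x / (4 * pi) - L x) has_real_derivative (1 - \<theta> x) / (4 * pi * x)) (at x)"
      using x by (auto intro!: derivative_eq_intros L_deriv simp: field_simps)
    with x eq_one show "\<exists>y. DERIV (\<lambda>x. ln x / (4 * pi) - L x) x :> y \<and> y \<le> 0" by fastforce
  qed
  with L_diff_le[OF assms(1,2)] show ?thesis by (simp add: diff_divide_distrib)
qed

lemma L_eq_0: assumes "1 \<le> s" shows "L s = 0"
proof -
  have "L s \<le> L 1"
  proof (rule DERIV_nonpos_imp_nonincreasing[OF assms])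
    fix x :: real assume "1 \<le> x"
    then show "\<exists>y. DERIV L x :> y \<and> y \<le> 0"
      using L_deriv[of x] eq_zero[of x] by (intro exI[of _ 0]) auto
  qed
  with L_mono[of 1 s] assms L_1 show ?thesis by auto
qed

lemma L_nonpos: "L s \<le> 0"
  using L_mono[of s 1] L_eq_0[of s] L_1 L_le_0[of s]
  by (cases "s \<le> 1"; cases "s > 0") auto

lemma L_ge: "- L s \<le> max 0 (- ln s) / (4 * pi)"
  using L_diff_le[of s 1] L_eq_0[of s] L_1 L_le_0[of s]
  by (cases "s \<le> 1"; cases "s > 0") (auto simp: max_def divide_nonneg_pos)

lemma L_measurable [measurable]: "L \<in> borel_measurable borel"
proof -
  have "continuous_on {0<..} L"
    by (intro continuous_at_imp_continuous_on) (auto intro: DERIV_isCont L_deriv)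
  then have "(\<lambda>s. indicator {0<..} s *\<^sub>R L s) \<in> borel_measurable borel"
    by (intro borel_measurable_continuous_on_indicator) auto
  moreover have "(\<lambda>s. indicator {0<..} s *\<^sub>R L s) = L"
    using L_le_0 by (auto split: split_indicator)
  ultimately show ?thesis by simp
qed

text \<open>The parameter \<open>a\<close> is a squared radius and the profile lives on the annulus
  \<open>a / 2 \<le> s \<le> a\<close>. The same kernel serves as an approximate identity for small
  \<open>a\<close> and as an average over a distant annulus for large \<open>a\<close>.\<close>

definition \<rho> :: "real \<Rightarrow> real \<Rightarrow> real" where
  "\<rho> a s = - d\<theta> (s / a) / (pi * a)"

lemma C_k_\<rho>: "C_k k (\<rho> a)"
proof -
  have "C_k k (\<lambda>s. (- 1 / (pi * a)) * d\<theta> (s * (1 / a)))"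
    by (intro C_k_cmult C_k_compose_scale C_k_d\<theta>)
  moreover have "\<rho> a = (\<lambda>s. (- 1 / (pi * a)) * d\<theta> (s * (1 / a)))"
    by (auto simp: \<rho>_def)
  ultimately show ?thesis by simp
qed

lemma \<rho>_measurable [measurable]: "\<rho> a \<in> borel_measurable borel"
  by (rule borel_measurable_continuous_onI[OF C_k_0D[OF C_k_\<rho>]])

lemma \<rho>_eq_0: "a > 0 \<Longrightarrow> \<bar>s\<bar> < a / 2 \<or> a \<le> s \<Longrightarrow> \<rho> a s = 0"
  unfolding \<rho>_def by (subst d\<theta>_eq_0) (auto simp: field_simps)

lemma \<rho>_bounded: "\<exists>M>0. \<forall>a>0. \<forall>s\<ge>0. \<bar>\<rho> a s\<bar> \<le> M / a"
proof -
  obtain M where M: "M > 0" "\<And>s. s \<ge> 0 \<Longrightarrow> \<bar>d\<theta> s\<bar> \<le> M" using d\<theta>_bounded by blast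
  show ?thesis
    using M by (intro exI[of _ "M / pi"]) (auto simp: \<rho>_def abs_mult divide_simps)
qed

text \<open>In the variable \<open>s\<close> the kernel is an exact derivative, so its integral is
  the drop of the cutoff from 1 at 0 to 0 at 1, whatever happens in between.\<close>

lemma integral_\<rho>:
  fixes x0 :: "real ^ 2"
  assumes "a > 0"
  shows "(LINT x|lborel. \<rho> a ((x - x0) \<bullet> (x - x0))) = 1"
proof -
  have "(LINT x|lborel. \<rho> a ((x - x0) \<bullet> (x - x0))) = pi * (LINT s:{0..}|lborel. \<rho> a s)"
    by (rule integral_dist_sq) simp
  also have "(LINT s:{0..}|lborel. \<rho> a s) = (LINT s|lborel. \<rho> a s * indicator {0..a} s)"
    unfolding set_lebesgue_integral_def using assms \<rho>_eq_0
    by (intro Bochner_Integration.integral_cong) (auto split: split_indicator)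
  also have "\<dots> = - \<theta> (a / a) / pi - (- \<theta> (0 / a) / pi)"
  proof (rule integral_FTC_Icc_real)
    fix s
    have "((\<lambda>s. \<theta> (s / a)) has_real_derivative d\<theta> (s / a) * (1 / a)) (at s)"
      by (rule DERIV_chain2[OF has_derivative_\<theta> DERIV_cdivide[OF DERIV_ident]])
    then show "((\<lambda>s. - \<theta> (s / a) / pi) has_real_derivative \<rho> a s) (at s)"
      unfolding \<rho>_def using assms by (auto intro!: derivative_eq_intros)
    show "isCont (\<rho> a) s"
      using C_k_0D[OF C_k_\<rho>[of 0 a]] by (simp add: continuous_on_eq_continuous_at)
  qed (use assms in auto)
  finally show ?thesis using assms eq_one[of 0] eq_zero[of 1] by simp
qed

text \<open>The size condition says that the inner circle of the annulus encloses the closed unit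
  disc, outside which the weak gradient is available.\<close>

lemma \<rho>_test_function:
  fixes x0 :: "real ^ 2"
  assumes "a > 0" and "1 + norm x0 < sqrt (a / 2)"
  shows "test_function_on (- cball 0 1) (\<lambda>x. \<rho> a ((x - x0) \<bullet> (x - x0)))"
proof (rule test_functionI_dist_sq[where b=a and T="- ball x0 (sqrt (a / 2))"])
  show "x \<in> - ball x0 (sqrt (a / 2))" if "\<rho> a ((x - x0) \<bullet> (x - x0)) \<noteq> 0" for x
  proof -
    have "a / 2 \<le> (x - x0) \<bullet> (x - x0)"
      using that \<rho>_eq_0[OF assms(1), of "(x - x0) \<bullet> (x - x0)"] by force
    then show ?thesis
      by (simp add: not_less dist_norm norm_eq_sqrt_inner inner_diff inner_commute)
  qed
  show "- ball x0 (sqrt (a / 2)) \<subseteq> - cball 0 1"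
  proof -
    have "dist x0 y \<le> norm x0 + norm y" for y
      by (simp add: dist_norm norm_triangle_ineq4)
    then show ?thesis using assms(2) by (auto simp: not_less) (smt (verit))
  qed
qed (use assms C_k_\<rho> \<rho>_eq_0 in auto)

text \<open>Both cutoffs equal 1 for \<open>s < a / 2\<close>, so the derivative \<open>g1\<close>
  of the difference of logarithms vanishes near 0. Integrating this smooth \<open>g1\<close> gives a
  function smooth on the whole line, which the formula in terms of \<open>L\<close> would not
  provide at \<open>s = 0\<close>.\<close>

lemma truncated_fundamental_solution:
  fixes x0 :: "real ^ 2"
  assumes "0 < a" "a \<le> b"
  obtains g where "test_function_on UNIV (\<lambda>x. g ((x - x0) \<bullet> (x - x0)))"
    and "\<And>s. s > 0 \<Longrightarrow> g s = L (s / b) - L (s / a)"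
    and "\<And>x. laplacian (\<lambda>x. g ((x - x0) \<bullet> (x - x0))) x =
        \<rho> a ((x - x0) \<bullet> (x - x0)) - \<rho> b ((x - x0) \<bullet> (x - x0))"
proof -
  define h where "h s = (\<theta> (s / b) - \<theta> (s / a)) / (4 * pi)" for s
  define g1 where "g1 s = h s / s" for s
  have b: "b > 0" using assms by simp
  have h0: "h s = 0" if "\<bar>s\<bar> < a / 2" for s
    using that assms b eq_one[of "s / a"] eq_one[of "s / b"]
    by (simp add: h_def field_simps)
  have h': "(h has_real_derivative (\<rho> a s - \<rho> b s) / 4) (at s)" for s
  proof -
    have "((\<lambda>s. \<theta> (s / c)) has_real_derivative d\<theta> (s / c) * (1 / c)) (at s)" for c
      by (rule DERIV_chain2[OF has_derivative_\<theta> DERIV_cdivide[OF DERIV_ident]])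
    note d = this[of a] this[of b]
    show ?thesis
      unfolding h_def \<rho>_def using assms b
      by (auto intro!: derivative_eq_intros d simp: diff_divide_distrib)
  qed
  have Ck_h: "C_k k h" for k
  proof -
    have "C_k k (\<lambda>s. 1 / (4 * pi) * (\<theta> (s * (1 / b)) + (- 1) * \<theta> (s * (1 / a))))"
      by (intro C_k_cmult C_k_add C_k_compose_scale smooth)
    moreover have "h = (\<lambda>s. 1 / (4 * pi) * (\<theta> (s * (1 / b)) + (- 1) * \<theta> (s * (1 / a))))"
      by (auto simp: h_def diff_divide_distrib)
    ultimately show ?thesis by simp
  qed
  have Ck_g1: "C_k k g1" for k
    using C_k_divide_power[OF Ck_h, of "a / 2" k 1] h0 assms by (simp add: g1_def[abs_def])
  have "isCont g1 s" for s
    using C_k_0D[OF Ck_g1[of 0]] by (simp add: continuous_on_eq_continuous_at)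
  then have "\<exists>F. \<forall>s. -\<infinity> < ereal s \<longrightarrow> s < \<infinity> \<longrightarrow> (F has_vector_derivative g1 s) (at s)"
    by (intro einterval_antiderivative) auto
  then obtain F where F: "\<And>s. (F has_real_derivative g1 s) (at s)"
    by (auto simp: has_real_derivative_iff_has_vector_derivative)
  define g where "g s = F s - F b" for s
  have g: "(g has_real_derivative g1 s) (at s)" for s
    unfolding g_def by (auto intro!: derivative_eq_intros F)
  have Ck_g: "C_k k g" for k
    using C_k_SucD[OF C_k_SucI_real[OF g Ck_g1]] .
  have g_eq: "g s = L (s / b) - L (s / a)" if "s > 0" for s
  proof -
    have "((\<lambda>s. L (s / b) - L (s / a)) has_real_derivative g1 s) (at s within {0<..})" if "s > 0"
        for s
    proof -
      have "((\<lambda>s. L (s / c)) has_real_derivative \<theta> (s / c) / (4 * pi * (s / c)) * (1 / c)) (at s)"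
        if "c > 0" for c
        using that \<open>s > 0\<close>
        by (intro DERIV_chain2[OF L_deriv DERIV_cdivide[OF DERIV_ident]]) auto
      note d = this[OF assms(1)] this[OF b]
      have "((\<lambda>s. L (s / b) - L (s / a)) has_real_derivative
          \<theta> (s / b) / (4 * pi * (s / b)) * (1 / b) -
              \<theta> (s / a) / (4 * pi * (s / a)) * (1 / a)) (at s)"
        by (rule DERIV_diff[OF d(2) d(1)])
      also have "\<theta> (s / b) / (4 * pi * (s / b)) * (1 / b) -
          \<theta> (s / a) / (4 * pi * (s / a)) * (1 / a) = g1 s"
        using assms b that by (simp add: g1_def h_def diff_divide_distrib)
      finally show ?thesis by (rule has_field_derivative_at_within)
    qed
    from DERIV_diff[OF has_field_derivative_at_within[OF g] this]
    have "((\<lambda>s. g s - (L (s / b) - L (s / a))) has_real_derivative 0) (at s within {0<..})" if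
        "s > 0" for s
      using that by fastforce
    then obtain c where c: "\<And>s. s > 0 \<Longrightarrow> g s - (L (s / b) - L (s / a)) = c"
      using has_field_derivative_zero_constant[of "{0<..}" "\<lambda>s. g s - (L (s / b) - L (s / a))"]
          by auto
    \<comment> \<open>At \<open>s = b\<close> both values of \<open>L\<close> are 0 because the
      arguments are at least 1, and \<open>g\<close> was normalised to vanish there.\<close>
    have "c = 0"
      using c[OF b] assms b by (simp add: g_def L_eq_0)
    with c[OF that] show ?thesis by simp
  qed
  have g0: "g s = 0" if "s \<ge> b" for s
    using that assms b g_eq[of s] by (simp add: L_eq_0)
  show ?thesis
  proof
    show "test_function_on UNIV (\<lambda>x. g ((x - x0) \<bullet> (x - x0)))"
      by (rule test_functionI_dist_sq[where b=b and T=UNIV]) (use Ck_g g0 in auto)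
    show "g s = L (s / b) - L (s / a)" if "s > 0" for s by (rule g_eq[OF that])
    define g2 where "g2 = pderivative 1 g1"
    have g2: "(g1 has_real_derivative g2 s) (at s)" for s
      unfolding g2_def by (rule C_k_SucD_real[OF Ck_g1])
    \<comment> \<open>The left side is the derivative of \<open>s * g1 s\<close>, which is
      \<open>h\<close>; at \<open>s = 0\<close> this uses \<open>h 0 = 0\<close>.\<close>
    have "g1 s + s * g2 s = (\<rho> a s - \<rho> b s) / 4" for s
    proof -
      have "(\<lambda>s. s * g1 s) = h" using h0[of 0] assms by (auto simp: g1_def)
      moreover have "((\<lambda>s. s * g1 s) has_real_derivative g1 s + s * g2 s) (at s)"
        by (auto intro!: derivative_eq_intros g2)
      ultimately show ?thesis using h' DERIV_unique by metis
    qed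
    note eq = this
    fix x
    have "laplacian (\<lambda>x. g ((x - x0) \<bullet> (x - x0))) x =
       4 * (g1 ((x - x0) \<bullet> (x - x0)) + ((x - x0) \<bullet> (x - x0)) * g2 ((x - x0) \<bullet> (x - x0)))"
      by (subst laplacian_compose_dist_sq[OF g g2]) (simp add: algebra_simps)
    then show "laplacian (\<lambda>x. g ((x - x0) \<bullet> (x - x0))) x =
        \<rho> a ((x - x0) \<bullet> (x - x0)) - \<rho> b ((x - x0) \<bullet> (x - x0))"
      unfolding eq by simp
  qed
qed

end

subsection \<open>Mollification and integrability\<close>

text \<open>If \<open>F\<close> is not integrable its integral is 0 by convention and the bound
  persists, so applications need no measurability argument for \<open>F\<close>.\<close>

lemma abs_integral_le:
  fixes F :: "'a \<Rightarrow> real"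
  assumes "integrable M g" and "\<And>x. \<bar>F x\<bar> \<le> g x"
  shows "\<bar>integral\<^sup>L M F\<bar> \<le> integral\<^sup>L M g"
proof (cases "integrable M F")
  case True
  have "\<bar>integral\<^sup>L M F\<bar> \<le> integral\<^sup>L M (\<lambda>x. \<bar>F x\<bar>)" by (rule integral_abs_bound)
  also have "\<dots> \<le> integral\<^sup>L M g" using True assms by (intro integral_mono) auto
  finally show ?thesis .
next
  case False
  have "0 \<le> g x" for x using assms(2)[of x] by linarith
  with False show ?thesis by (simp add: not_integrable_integral_eq integral_nonneg_AE)
qed

text \<open>Passing to the gauge integral over a fixed box makes the Leibniz rule for parameter
  integrals applicable.\<close>

lemma continuous_compact_support_integrable:
  fixes h :: "'a::euclidean_space \<Rightarrow> real"
  assumes "continuous_on UNIV h" and "\<And>x. h x \<noteq> 0 \<Longrightarrow> x \<in> cbox l m"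
  shows "integrable lebesgue h" and "integral\<^sup>L lebesgue h = integral (cbox l m) h"
proof -
  have h: "(\<lambda>x. if x \<in> cbox l m then h x else 0) = h" using assms(2) by fastforce
  have "integrable (lebesgue_on (cbox l m)) h"
    using assms(1) continuous_on_subset by (blast intro: continuous_imp_integrable)
  then show i: "integrable lebesgue h"
    using Lebesgue_Measure.integrable_restrict_UNIV[of "cbox l m" h] h by simp
  have "integral\<^sup>L lebesgue h = integral UNIV h"
    using has_integral_integral_lebesgue[OF i] by (simp add: integral_unique)
  also have "\<dots> = integral (cbox l m) h"
    using Henstock_Kurzweil_Integration.integral_restrict_UNIV[of "cbox l m" h] h by simp
  finally show "integral\<^sup>L lebesgue h = integral (cbox l m) h" .
qed

lemma cball_subset_cbox:
  fixes x0 :: "'a::euclidean_space"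
  obtains l m where "cball x0 R \<subseteq> cbox l m"
  using bounded_subset_cbox_symmetric[OF bounded_cball] by blast

lemma AE_lebesgue_neq: "AE y in lebesgue. y \<noteq> (x0 :: 'a::euclidean_space)"
  by (intro AE_I'[of "{x0}"]) auto

lemma integrable_ln_pos:
  fixes a :: "real ^ 2"
  assumes "r > 0"
  shows "integrable lebesgue (\<lambda>x. max 0 (ln (r / norm (x - a))))"
proof -
  have "integrable lborel (\<lambda>x. max 0 (ln (r / norm (x - a))))"
  proof (rule integrableI_bounded)
    have "(\<integral>\<^sup>+x. ennreal (norm (max 0 (ln (r / norm (x - a))))) \<partial>lborel) \<le> ennreal (2 * pi * r\<^sup>2)"
      using nn_integral_ln_pos[OF assms, of a] by simp
    also have "\<dots> < \<infinity>" by simp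
    finally show "(\<integral>\<^sup>+x. ennreal (norm (max 0 (ln (r / norm (x - a))))) \<partial>lborel) < \<infinity>" .
  qed simp
  then show ?thesis by (subst integrable_completion) auto
qed

lemma integral_ln_pos_le:
  fixes a :: "real ^ 2"
  assumes "r > 0"
  shows "(LINT x|lebesgue. max 0 (ln (r / norm (x - a)))) \<le> 2 * pi * r\<^sup>2"
proof -
  have "(LINT x|lebesgue. max 0 (ln (r / norm (x - a)))) =
      enn2real (\<integral>\<^sup>+x. ennreal (max 0 (ln (r / norm (x - a)))) \<partial>lborel)"
    by (subst integral_eq_nn_integral)
       (auto simp: nn_integral_completion intro!: borel_measurable_integrable integrable_ln_pos
           assms)
  also have "\<dots> \<le> enn2real (ennreal (2 * pi * r\<^sup>2))"
    by (intro enn2real_mono nn_integral_ln_pos assms) auto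
  finally show ?thesis by simp
qed

context plane_cutoff
begin

abbreviation mollifier :: "real \<Rightarrow> real ^ 2 \<Rightarrow> real ^ 2 \<Rightarrow> real" where
  "mollifier b x0 x \<equiv> \<rho> b ((x - x0) \<bullet> (x - x0))"

lemma continuous_on_mollifier [continuous_intros]:
  assumes "continuous_on S f" "continuous_on S g"
  shows "continuous_on S (\<lambda>x. mollifier b (f x) (g x))"
  by (intro continuous_on_compose2[OF C_k_0D[OF C_k_\<rho>[of 0 b]]] continuous_intros assms) auto

lemma mollifier_support:
  assumes "b > 0" "mollifier b x0 x \<noteq> 0"
  shows "sqrt (b / 2) \<le> norm (x - x0)" "norm (x - x0) < sqrt b"
proof -
  have "b / 2 \<le> (norm (x - x0))\<^sup>2" "(norm (x - x0))\<^sup>2 < b"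
    unfolding power2_norm_eq_inner
    using \<rho>_eq_0[OF assms(1), of "(x - x0) \<bullet> (x - x0)"] assms(2) by fastforce+
  then show "sqrt (b / 2) \<le> norm (x - x0)" "norm (x - x0) < sqrt b"
    by (auto intro: real_le_lsqrt real_less_rsqrt)
qed

lemma integrable_mult_mollifier:
  assumes "b > 0" "continuous_on UNIV w"
  shows "integrable lebesgue (\<lambda>x. w x * mollifier b x0 x)"
proof -
  obtain l m where lm: "cball x0 (sqrt b) \<subseteq> cbox l m" by (rule cball_subset_cbox)
  show ?thesis
  proof (rule continuous_compact_support_integrable(1)[where l=l and m=m])
    show "x \<in> cbox l m" if "w x * mollifier b x0 x \<noteq> 0" for x
    proof -
      from that have "norm (x - x0) < sqrt b" by (intro mollifier_support[OF assms(1)]) auto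
      then have "x \<in> cball x0 (sqrt b)" by (simp add: dist_norm norm_minus_commute)
      with lm show ?thesis by blast
    qed
  qed (intro continuous_intros assms)
qed

lemma integral_mollifier:
  assumes "b > 0" shows "integral\<^sup>L lebesgue (mollifier b x0) = 1"
  using integral_\<rho>[OF assms] by (subst integral_completion) auto

text \<open>The kernel is at most a constant over \<open>b\<close>, and its support lies in a disc
  of area \<open>pi * b\<close>. The resulting constant is independent of scale and centre and
  replaces the bound 1 that a nonnegative kernel would give.\<close>

lemma integral_mollifier_bound:
  "\<exists>M>0. \<forall>b>0. \<forall>x0 h e. (\<forall>x. sqrt (b / 2) \<le> norm (x - x0) \<and> norm (x - x0) < sqrt b \<longrightarrow> \<bar>h x\<bar> \<le> e) \<longrightarrow>
     \<bar>LINT x|lebesgue. h x * mollifier b x0 x\<bar> \<le> M * e"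
proof -
  obtain M where M: "M > 0" "\<And>a s. a > 0 \<Longrightarrow> s \<ge> 0 \<Longrightarrow> \<bar>\<rho> a s\<bar> \<le> M / a" using \<rho>_bounded by blast
  show ?thesis
  proof (intro exI[of _ "M * pi"] conjI allI impI)
    fix b e :: real and x0 :: "real ^ 2" and h :: "real ^ 2 \<Rightarrow> real"
    assume b: "b > 0" and h: "\<forall>x. sqrt (b / 2) \<le> norm (x - x0) \<and> norm (x - x0) < sqrt b \<longrightarrow> \<bar>h x\<bar> \<le> e"
    \<comment> \<open>A point on the inner circle of the annulus witnesses that \<open>e\<close> is
      nonnegative.\<close>
    have "\<bar>h (x0 + sqrt (b / 2) *\<^sub>R axis 1 1)\<bar> \<le> e"
      using b by (intro h[rule_format]) (auto intro: real_sqrt_less_mono)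
    then have e: "e \<ge> 0" by linarith
    have "\<bar>LINT x|lebesgue. h x * mollifier b x0 x\<bar> \<le>
        (LINT x|lebesgue. indicator (cball x0 (sqrt b)) x * (e * (M / b)))"
    proof (rule abs_integral_le)
      have "emeasure lebesgue (cball x0 (sqrt b)) < \<infinity>" using emeasure_lborel_cball_finite
          by (simp add: emeasure_completion)
      then show "integrable lebesgue (\<lambda>x. indicator (cball x0 (sqrt b)) x * (e * (M / b)))"
        by (intro integrable_mult_left) auto
      fix x
      show "\<bar>h x * mollifier b x0 x\<bar> \<le> indicator (cball x0 (sqrt b)) x * (e * (M / b))"
      proof (cases "mollifier b x0 x = 0")
        case False
        note s = mollifier_support[OF b False]
        then have "\<bar>h x\<bar> * \<bar>mollifier b x0 x\<bar> \<le> e * (M / b)"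
          using e M(2)[OF b, of "(x - x0) \<bullet> (x - x0)"] h by (intro mult_mono) auto
        with s show ?thesis by (simp add: abs_mult dist_norm norm_minus_commute)
      qed (use e M b in auto)
    qed
    also have "\<dots> = e * (M / b) * (pi * b)"
      using b by (simp add: content_cball unit_ball_vol_2)
    also have "\<dots> = M * pi * e" using b by simp
    finally show "\<bar>LINT x|lebesgue. h x * mollifier b x0 x\<bar> \<le> M * pi * e" .
  qed (use M in auto)
qed

lemma mollifier_tendsto:
  assumes u: "continuous_on UNIV u" and a: "\<And>n. a n > 0" "a \<longlonglongrightarrow> 0"
  shows "(\<lambda>n. LINT x|lebesgue. u x * mollifier (a n) x0 x) \<longlonglongrightarrow> u x0"
proof (rule LIMSEQ_I)
  fix e :: real assume "e > 0"
  obtain M where M: "M > 0" "\<And>b x0 h e. b > 0 \<Longrightarrow> (\<And>x. sqrt (b / 2) \<le> norm (x - x0) \<Longrightarrow>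
      norm (x - x0) < sqrt b \<Longrightarrow> \<bar>h x\<bar> \<le> e) \<Longrightarrow>
     \<bar>LINT x|lebesgue. h x * mollifier b x0 x\<bar> \<le> M * e" using integral_mollifier_bound by blast
  have "isCont u x0" using u by (simp add: continuous_on_eq_continuous_at)
  then obtain d where d: "d > 0" "\<And>x. norm (x - x0) < d \<Longrightarrow> \<bar>u x - u x0\<bar> < e / (2 * M)"
    unfolding continuous_at_eps_delta using \<open>e > 0\<close> M(1)
    by (metis dist_norm dist_real_def divide_pos_pos mult_pos_pos zero_less_numeral)
  from LIMSEQ_D[OF a(2), of "d\<^sup>2"] d(1)
  obtain N where N: "\<And>n. n \<ge> N \<Longrightarrow> \<bar>a n\<bar> < d\<^sup>2" by auto
  show "\<exists>no. \<forall>n\<ge>no. norm ((LINT x|lebesgue. u x * mollifier (a n) x0 x) - u x0) < e"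
  proof (intro exI allI impI)
    fix n assume n: "n \<ge> N"
    have "sqrt (a n) < d" using N[OF n] d(1) by (intro real_less_lsqrt) auto
    have i: "integrable lebesgue (\<lambda>x. w * mollifier (a n) x0 x)" for w
      by (rule integrable_mult_mollifier) (auto simp: a)
    have "(LINT x|lebesgue. u x * mollifier (a n) x0 x) - u x0 =
        (LINT x|lebesgue. u x * mollifier (a n) x0 x) -
            (LINT x|lebesgue. u x0 * mollifier (a n) x0 x)"
      using a(1) integral_mollifier by simp
    also have "\<dots> = (LINT x|lebesgue. (u x - u x0) * mollifier (a n) x0 x)"
      using integrable_mult_mollifier[OF a(1) u, of n x0] i[of "u x0"]
      by (subst Bochner_Integration.integral_diff[symmetric]) (auto simp: algebra_simps)
    finally have eq: "(LINT x|lebesgue. u x * mollifier (a n) x0 x) - u x0 =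
        (LINT x|lebesgue. (u x - u x0) * mollifier (a n) x0 x)" .
    have "\<bar>LINT x|lebesgue. (u x - u x0) * mollifier (a n) x0 x\<bar> \<le> M * (e / (2 * M))"
      using d(2) \<open>sqrt (a n) < d\<close> by (intro M(2) a(1) less_imp_le) auto
    also have "\<dots> < e" using M(1) \<open>e > 0\<close> by simp
    finally show "norm ((LINT x|lebesgue. u x * mollifier (a n) x0 x) - u x0) < e"
      unfolding eq by simp
  qed
qed

end

subsection \<open>The representation formula\<close>

lemma continuous_on_ln_max_norm: "continuous_on S (\<lambda>x. ln (max 1 (norm x)))"
proof -
  have "max 1 (norm x) \<noteq> 0" for x :: 'a by (auto simp: max_def)
  then show ?thesis by (intro continuous_intros) auto
qed

lemma (in plane_cutoff) abs_L_diff_le: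
  assumes "0 < s" "0 < t"
  shows "\<bar>L s - L t\<bar> \<le> \<bar>ln s - ln t\<bar> / (4 * pi)"
proof -
  have *: "\<bar>L s - L t\<bar> \<le> \<bar>ln s - ln t\<bar> / (4 * pi)" if "0 < s" "s \<le> t" for s t
  proof -
    have "\<bar>L s - L t\<bar> = L t - L s" "\<bar>ln s - ln t\<bar> = ln t - ln s"
      using L_mono[OF that] ln_mono[OF that(2,1)] by auto
    then show ?thesis using L_diff_le[OF that] by simp
  qed
  show ?thesis
    using *[of s t] *[of t s] assms by (cases "s \<le> t") (auto simp: abs_minus_commute)
qed

text \<open>The nonlinearity is forgotten here: \<open>f\<close> is a given nonnegative integrable
  right-hand side. Local boundedness makes its logarithmic potential finite at every point, and not
  just almost everywhere.\<close>

locale planar_solution = plane_cutoff +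
  fixes u f :: "real ^ 2 \<Rightarrow> real" and \<alpha> :: real and G :: "real ^ 2 \<Rightarrow> real ^ 2"
  assumes continuous_u: "continuous_on UNIV u"
    and f_nonneg: "0 \<le> f x"
    and f_integrable: "integrable lebesgue f"
    and f_locally_bounded: "\<exists>B. \<forall>x. norm x \<le> R \<longrightarrow> f x \<le> B"
    and equation: "test_function_on UNIV \<phi> \<Longrightarrow>
      (LINT x|lebesgue. u x * laplacian \<phi> x - f x * \<phi> x) = 0"
    and gradient: "weak_gradient_on (- cball 0 1) (\<lambda>x. u x - \<alpha> * ln (norm x)) G"
    and energy: "(\<lambda>x. (norm (G x))\<^sup>2) absolutely_integrable_on (- ball 0 1)"
begin

lemma f_measurable [measurable]: "f \<in> borel_measurable lebesgue"
  using f_integrable by (rule borel_measurable_integrable)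

text \<open>The positive part confines the integrand to a disc of radius \<open>r\<close>, where
  \<open>f\<close> is bounded and the logarithmic singularity is integrable in the plane.\<close>

lemma f_ln_pos_integrable:
  assumes "r > 0"
  shows "integrable lebesgue (\<lambda>y. f y * max 0 (ln (r / norm (y - a))))"
proof -
  obtain B where B: "\<And>x. norm x \<le> norm a + r \<Longrightarrow> f x \<le> B"
    using f_locally_bounded[of "norm a + r"] by blast
  have [measurable]: "(\<lambda>y. max 0 (ln (r / norm (y - a)))) \<in> borel_measurable lebesgue"
    by (rule borel_measurable_integrable[OF integrable_ln_pos[OF assms]])
  show ?thesis
  proof (rule Bochner_Integration.integrable_bound)
    show "integrable lebesgue (\<lambda>y. \<bar>B\<bar> * max 0 (ln (r / norm (y - a))))"
      by (intro integrable_mult_right integrable_ln_pos assms)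
    show "AE y in lebesgue. norm (f y * max 0 (ln (r / norm (y - a)))) \<le>
        norm (\<bar>B\<bar> * max 0 (ln (r / norm (y - a))))"
    proof (rule AE_I2)
      fix y
      show "norm (f y * max 0 (ln (r / norm (y - a)))) \<le> norm (\<bar>B\<bar> * max 0 (ln (r / norm (y - a))))"
      proof (cases "norm (y - a) \<le> r")
        case True
        then have "norm y \<le> norm a + r" using norm_triangle_sub[of y a] by linarith
        then have "\<bar>f y\<bar> \<le> \<bar>B\<bar>" using B[of y] f_nonneg[of y] by linarith
        then show ?thesis by (auto simp: abs_mult intro!: mult_right_mono)
      next
        case False
        then have "ln (r / norm (y - a)) \<le> 0"
          using assms by (intro ln_le_zero_iff[THEN iffD2] divide_pos_pos divide_le_eq_1_pos[THEN
              iffD2]) auto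
        then show ?thesis by (simp add: max_absorb1)
      qed
    qed
  qed measurable
qed

lemma f_L_integrable:
  assumes "b > 0"
  shows "integrable lebesgue (\<lambda>y. f y * L ((y - a) \<bullet> (y - a) / b))"
proof (rule Bochner_Integration.integrable_bound)
  show "integrable lebesgue (\<lambda>y. 1 / (2 * pi) * (f y * max 0 (ln (sqrt b / norm (y - a)))))"
    using assms by (intro integrable_mult_right f_ln_pos_integrable) auto
  have [measurable]: "(\<lambda>y. L ((y - a) \<bullet> (y - a) / b)) \<in> borel_measurable lebesgue"
    by (intro measurable_completion) measurable
  show "(\<lambda>y. f y * L ((y - a) \<bullet> (y - a) / b)) \<in> borel_measurable lebesgue" by measurable
  show "AE y in lebesgue. norm (f y * L ((y - a) \<bullet> (y - a) / b)) \<le>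
      norm (1 / (2 * pi) * (f y * max 0 (ln (sqrt b / norm (y - a)))))"
    using AE_lebesgue_neq[of a]
  proof eventually_elim
    case (elim y)
    have "- ln ((y - a) \<bullet> (y - a) / b) = 2 * ln (sqrt b / norm (y - a))"
      using elim assms by (simp add: dot_square_norm ln_div ln_realpow ln_sqrt)
    then have "\<bar>L ((y - a) \<bullet> (y - a) / b)\<bar> \<le> max 0 (ln (sqrt b / norm (y - a))) / (2 * pi)"
      using L_ge[of "(y - a) \<bullet> (y - a) / b"] L_nonpos[of "(y - a) \<bullet> (y - a) / b"]
      by (simp add: max_def split: if_splits)
    from mult_left_mono[OF this f_nonneg[of y]] show ?case
      using f_nonneg[of y] by (simp add: abs_mult)
  qed
qed

text \<open>Test the equation with the truncated fundamental solutions at scales \<open>a n\<close>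
  and \<open>b\<close>. As \<open>a n\<close> tends to 0, the inner kernel recovers
  \<open>u x0\<close> by continuity and the outer one stays fixed.\<close>

lemma local_representation:
  assumes b: "b > 0"
  shows "u x0 = (LINT x|lebesgue. u x * mollifier b x0 x) +
      (LINT y|lebesgue. f y * L ((y - x0) \<bullet> (y - x0) / b))"
proof -
  define N where "N x = (x - x0) \<bullet> (x - x0)" for x
  define a where "a n = b / real (Suc n)" for n
  have a: "0 < a n" "a n \<le> b" for n using b by (auto simp: a_def field_simps)
  have a0: "a \<longlonglongrightarrow> 0" unfolding a_def by real_asymp
  have "\<exists>g. test_function_on UNIV (\<lambda>x. g (N x)) \<and> (\<forall>s>0. g s = L (s / b) - L (s / a n)) \<and>
      (\<forall>x. laplacian (\<lambda>x. g (N x)) x = \<rho> (a n) (N x) - \<rho> b (N x))" for n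
    unfolding N_def by (rule truncated_fundamental_solution[OF a, where ?x0.0=x0]) blast
  then obtain g where g: "\<And>n. test_function_on UNIV (\<lambda>x. g n (N x))"
      "\<And>n s. s > 0 \<Longrightarrow> g n s = L (s / b) - L (s / a n)"
      "\<And>n x. laplacian (\<lambda>x. g n (N x)) x = \<rho> (a n) (N x) - \<rho> b (N x)"
    by metis
  have N_pos: "N y > 0" if "y \<noteq> x0" for y using that by (simp add: N_def)
  \<comment> \<open>Monotonicity and \<open>L \<le> 0\<close> place \<open>g n\<close> between
    \<open>L (N y / b)\<close> and 0, a majorant independent of \<open>n\<close>.\<close>
  have g_bound: "\<bar>f y * g n (N y)\<bar> \<le> - (f y * L (N y / b))" if "y \<noteq> x0" for n y
  proof -
    have "L (N y / b) \<le> L (N y / a n)"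
      using N_pos[OF that] a b by (intro L_mono) (auto intro: divide_left_mono)
    then have "\<bar>g n (N y)\<bar> \<le> - L (N y / b)"
      using g(2)[OF N_pos[OF that], of n] L_nonpos[of "N y / a n"] by linarith
    from mult_left_mono[OF this f_nonneg[of y]] show ?thesis
      using f_nonneg[of y] by (simp add: abs_mult)
  qed
  have [measurable]: "(\<lambda>y. g n (N y)) \<in> borel_measurable lebesgue" for n
  proof -
    have "continuous_on UNIV (\<lambda>y. g n (N y))"
      using g(1)[of n] C_k_0D by (auto simp: test_function_on_def C_infinity_def)
    then show ?thesis by (intro measurable_completion) (auto intro: borel_measurable_continuous_onI)
  qed
  have fL: "integrable lebesgue (\<lambda>y. f y * L (N y / b))"
    unfolding N_def by (rule f_L_integrable[OF b])
  then have fL': "integrable lebesgue (\<lambda>y. - (f y * L (N y / b)))" by simp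
  have fg: "integrable lebesgue (\<lambda>y. f y * g n (N y))" for n
  proof (rule Bochner_Integration.integrable_bound[OF fL'])
    show "AE y in lebesgue. norm (f y * g n (N y)) \<le> norm (- (f y * L (N y / b)))"
      using AE_lebesgue_neq[of x0]
      by eventually_elim (metis abs_ge_self g_bound order_trans real_norm_def)
  qed measurable
  have lim1: "(\<lambda>n. LINT y|lebesgue. f y * g n (N y)) \<longlonglongrightarrow> (LINT y|lebesgue. f y * L (N y / b))"
  proof (rule integral_dominated_convergence[where w="\<lambda>y. - (f y * L (N y / b))"])
    show "AE y in lebesgue. norm (f y * g n (N y)) \<le> - (f y * L (N y / b))" for n
      using AE_lebesgue_neq[of x0] g_bound by (auto elim!: eventually_mono)
    show "AE y in lebesgue. (\<lambda>n. f y * g n (N y)) \<longlonglongrightarrow> f y * L (N y / b)"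
      using AE_lebesgue_neq[of x0]
    proof eventually_elim
      case (elim y)
      \<comment> \<open>Once \<open>a n < N y\<close> the inner truncation vanishes at
        \<open>y\<close>, so the sequence is eventually constant.\<close>
      have "\<forall>\<^sub>F n in sequentially. a n < N y"
        using order_tendstoD(2)[OF a0 N_pos[OF elim]] .
      then have "\<forall>\<^sub>F n in sequentially. f y * g n (N y) = f y * L (N y / b)"
        by eventually_elim (use g(2)[OF N_pos[OF elim]] a L_eq_0 in simp)
      then show ?case by (rule tendsto_eventually)
    qed
  qed (use fL fL' fg in auto)
  have eq: "(LINT y|lebesgue. f y * g n (N y)) =
      (LINT x|lebesgue. u x * \<rho> (a n) (N x)) - (LINT x|lebesgue. u x * \<rho> b (N x))" for n
  proof -
    note i = integrable_mult_mollifier[OF a(1) continuous_u, of n x0, folded N_def]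
      integrable_mult_mollifier[OF b continuous_u, of x0, folded N_def]
    have "0 = (LINT x|lebesgue. u x * laplacian (\<lambda>x. g n (N x)) x - f x * g n (N x))"
      using equation[OF g(1)[of n]] by simp
    also have "\<dots> = (LINT x|lebesgue. (u x * \<rho> (a n) (N x) - u x * \<rho> b (N x)) - f x * g n (N x))"
      unfolding g(3) by (simp add: algebra_simps)
    also have "\<dots> = (LINT x|lebesgue. u x * \<rho> (a n) (N x)) - (LINT x|lebesgue. u x * \<rho> b (N x)) -
        (LINT y|lebesgue. f y * g n (N y))"
      using i fg[of n] by simp
    finally show ?thesis by simp
  qed
  have "(\<lambda>n. LINT y|lebesgue. f y * g n (N y)) \<longlonglongrightarrow> u x0 - (LINT x|lebesgue. u x * \<rho> b (N x))"
    unfolding eq unfolding N_def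
    by (intro tendsto_diff tendsto_const mollifier_tendsto continuous_u a a0)
  from LIMSEQ_unique[OF this lim1] show ?thesis by (simp add: N_def)
qed

section \<open>Averages over large annuli and the energy condition\<close>

text \<open>The average of the logarithm of the distance to the centre of the annulus depends on the
  radius only. Measuring the distance from the origin instead changes the logarithm by at most order
  \<open>norm a / sqrt b\<close>.\<close>

lemma ln_mollifier_diff_tendsto:
  "(\<lambda>n. (LINT x|lebesgue. ln (max 1 (norm x)) * mollifier (real n) x0 x) -
        (LINT x|lebesgue. ln (max 1 (norm x)) * mollifier (real n) x1 x)) \<longlonglongrightarrow> 0"
proof -
  obtain M where M: "M > 0" "\<And>b x0 h e. b > 0 \<Longrightarrow> (\<And>x. sqrt (b / 2) \<le> norm (x - x0) \<Longrightarrow>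
      norm (x - x0) < sqrt b \<Longrightarrow> \<bar>h x\<bar> \<le> e) \<Longrightarrow>
     \<bar>LINT x|lebesgue. h x * mollifier b x0 x\<bar> \<le> M * e" using integral_mollifier_bound by blast
  \<comment> \<open>The maximum with \<open>b / 4\<close> alters the logarithm only where the kernel
    vanishes and makes it continuous at 0.\<close>
  define c where "c b = pi * (LINT s:{0..}|lborel. ln (max (b / 4) s) / 2 * \<rho> b s)" for b
  have "(\<lambda>n. (LINT x|lebesgue. ln (max 1 (norm x)) * mollifier (real n) a x) - c (real n)) \<longlonglongrightarrow> 0" for a
  proof (rule Lim_null_comparison)
    define e where "e b = norm a / (sqrt (b / 2) - norm a)" for b
    \<comment> \<open>This puts the annulus outside the unit disc, so the truncation
      \<open>max 1\<close> is inactive on it.\<close>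
    have "\<forall>\<^sub>F n in sequentially. sqrt (real n / 2) \<ge> 2 + norm a" by real_asymp
    then show "\<forall>\<^sub>F n in sequentially. norm ((LINT x|lebesgue. ln (max 1 (norm x)) *
        mollifier (real n) a x) - c (real n)) \<le> M * e (real n)"
    proof eventually_elim
      case (elim n)
      define b where "b = real n"
      have b: "b > 0" "sqrt (b / 2) \<ge> 2 + norm a"
        using elim norm_ge_zero[of a] by (auto simp: b_def intro!: Nat.gr0I simp del: norm_ge_zero)
      define l where "l x = ln (max (b / 4) ((x - a) \<bullet> (x - a))) / 2" for x
      have cont: "continuous_on UNIV l" "continuous_on UNIV (\<lambda>x. ln (max 1 (norm x)))"
        unfolding l_def using b
        by (auto intro!: continuous_intros continuous_on_ln_max_norm simp: max_def[of _ 0])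
      have "c b = (LINT x|lborel. l x * mollifier b a x)"
        unfolding c_def l_def by (subst integral_dist_sq[symmetric, of _ a]) auto
      also have "\<dots> = (LINT x|lebesgue. l x * mollifier b a x)"
        by (subst integral_completion) (auto simp: l_def)
      finally have c: "c b = \<dots>" .
      have "(LINT x|lebesgue. ln (max 1 (norm x)) * mollifier b a x) - c b =
          (LINT x|lebesgue. (ln (max 1 (norm x)) - l x) * mollifier b a x)"
        unfolding c left_diff_distrib
        by (intro Bochner_Integration.integral_diff[symmetric] integrable_mult_mollifier b cont)
      moreover have "\<bar>LINT x|lebesgue. (ln (max 1 (norm x)) - l x) * mollifier b a x\<bar> \<le> M * e b"
      proof (rule M(2)[OF b(1)])
        fix x assume x: "sqrt (b / 2) \<le> norm (x - a)"
        have "b / 2 \<le> (norm (x - a))\<^sup>2"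
          using x b(1) by (metis real_sqrt_le_iff real_sqrt_abs abs_norm_cancel)
        then have l: "l x = ln (norm (x - a))"
          using b x norm_ge_zero[of a] by (simp add: l_def dot_square_norm max_def ln_realpow)
        have nx: "norm x \<ge> norm (x - a) - norm a" "norm x \<le> norm (x - a) + norm a"
          using norm_triangle_ineq4[of x a] norm_triangle_sub[of x a] by linarith+
        then have n1: "norm x \<ge> 1" "norm x > 0" "norm (x - a) > 0"
          using x b(2) norm_ge_zero[of a] by linarith+
        have "ln (norm x) - ln (norm (x - a)) \<le> norm x / norm (x - a) - 1"
          using n1 ln_le_minus_one[of "norm x / norm (x - a)"] by (simp add: ln_div)
        also have "norm x / norm (x - a) - 1 = (norm x - norm (x - a)) / norm (x - a)"
          using n1 by (simp add: diff_divide_distrib)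
        also have "\<dots> \<le> norm a / norm (x - a)"
          using n1 nx by (intro divide_right_mono) linarith+
        also have "\<dots> \<le> e b"
          unfolding e_def using x b(2) n1 norm_ge_zero[of a]
              by (intro divide_left_mono mult_pos_pos) linarith+
        finally have 1: "ln (norm x) - ln (norm (x - a)) \<le> e b" .
        have "ln (norm (x - a)) - ln (norm x) \<le> norm (x - a) / norm x - 1"
          using n1 ln_le_minus_one[of "norm (x - a) / norm x"] by (simp add: ln_div)
        also have "norm (x - a) / norm x - 1 = (norm (x - a) - norm x) / norm x"
          using n1 by (simp add: diff_divide_distrib)
        also have "\<dots> \<le> norm a / norm x"
          using n1 nx by (intro divide_right_mono) linarith+
        also have "\<dots> \<le> e b"
          unfolding e_def using x b(2) n1 nx norm_ge_zero[of a]
              by (intro divide_left_mono mult_pos_pos) linarith+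
        finally show "\<bar>ln (max 1 (norm x)) - l x\<bar> \<le> e b" using 1 n1 l by (simp add: max_def)
      qed
      ultimately show ?case by (simp add: b_def)
    qed
    show "(\<lambda>n. M * e (real n)) \<longlonglongrightarrow> 0" unfolding e_def by real_asymp
  qed
  from tendsto_diff[OF this[of x0] this[of x1]] show ?thesis by simp
qed

text \<open>Young's inequality with weight \<open>sqrt b\<close>: the gradient term costs \<open>1 / sqrt b\<close> times the
  energy, and the remainder is integrated over a disc of area \<open>\<pi>b\<close>.\<close>

lemma mollifier_energy_bound:
  "\<exists>K. \<forall>b x0 e. b > 0 \<longrightarrow> 1 + norm x0 < sqrt (b / 2) \<longrightarrow> e \<in> Basis \<longrightarrow>
     \<bar>LINT x|lebesgue. (u x - \<alpha> * ln (norm x)) * pderivative e (mollifier b x0) x\<bar> \<le> K / sqrt b"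
proof -
  obtain M where M: "M > 0" "\<And>a s. a > 0 \<Longrightarrow> s \<ge> 0 \<Longrightarrow> \<bar>\<rho> a s\<bar> \<le> M / a" using \<rho>_bounded by blast
  define g where "g x = indicator (- ball 0 1) x * (norm (G x))\<^sup>2" for x
  have g: "integrable lebesgue g"
    using energy by (simp add: g_def[abs_def] set_integrable_def)
  show ?thesis
  proof (intro exI allI impI)
    fix b :: real and x0 e :: "real ^ 2"
    assume b: "b > 0" and large: "1 + norm x0 < sqrt (b / 2)" and e: "e \<in> Basis"
    let ?\<phi> = "mollifier b x0" and ?C = "cball x0 (sqrt b)"
    let ?w = "\<lambda>x. M / b * (sqrt b * g x + 1 / sqrt b * indicator ?C x)"
    have C: "integrable lebesgue (indicator ?C :: _ \<Rightarrow> real)"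
      using emeasure_lborel_cball_finite[of x0 "sqrt b"]
      by (intro integrable_real_indicator) (simp_all add: emeasure_completion)
    have "(LINT x|lebesgue. (u x - \<alpha> * ln (norm x)) * pderivative e ?\<phi> x) =
        - (LINT x|lebesgue. (G x \<bullet> e) * ?\<phi> x)"
      using gradient \<rho>_test_function[OF b large] e unfolding weak_gradient_on_def by blast
    moreover have "\<bar>LINT x|lebesgue. (G x \<bullet> e) * ?\<phi> x\<bar> \<le> integral\<^sup>L lebesgue ?w"
    proof (rule abs_integral_le)
      show "integrable lebesgue ?w" using g C by (intro integrable_mult_right integrable_add) auto
      fix x
      show "\<bar>(G x \<bullet> e) * ?\<phi> x\<bar> \<le> ?w x"
      proof (cases "?\<phi> x = 0")
        case True
        have "0 \<le> ?w x" using b M by (auto simp: g_def)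
        with True show ?thesis by simp
      next
        case False
        note s = mollifier_support[OF b False]
        have "norm x \<ge> 1" using s(1) large norm_triangle_ineq4[of x x0] by linarith
        then have gx: "g x = (norm (G x))\<^sup>2" by (simp add: g_def)
        have "\<bar>G x \<bullet> e\<bar> \<le> norm (G x)" by (rule Basis_le_norm[OF e])
        also have "\<dots> \<le> sqrt b * (norm (G x))\<^sup>2 + 1 / sqrt b"
        proof -
          have "2 * (sqrt b * norm (G x)) \<le> (sqrt b * norm (G x))\<^sup>2 + 1"
            using zero_le_power2[of "sqrt b * norm (G x) - 1"] by (simp add: power2_diff)
          then have "sqrt b * norm (G x) \<le> (sqrt b * norm (G x))\<^sup>2 + 1"
            using b mult_nonneg_nonneg[of "sqrt b" "norm (G x)"]
                by (smt (verit) norm_ge_zero real_sqrt_ge_zero)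
          then have "sqrt b * norm (G x) \<le> sqrt b * (sqrt b * (norm (G x))\<^sup>2 + 1 / sqrt b)"
            using b by (simp add: power2_eq_square algebra_simps)
          then show ?thesis using b by simp
        qed
        finally have "\<bar>G x \<bullet> e\<bar> \<le> sqrt b * g x + 1 / sqrt b * indicator ?C x"
          using gx s(2) by (simp add: dist_norm norm_minus_commute)
        moreover have "\<bar>?\<phi> x\<bar> \<le> M / b" using M(2)[OF b, of "(x - x0) \<bullet> (x - x0)"] by simp
        ultimately have "\<bar>G x \<bullet> e\<bar> * \<bar>?\<phi> x\<bar> \<le> (sqrt b * g x + 1 / sqrt b * indicator ?C x) * (M / b)"
          by (intro mult_mono) auto
        then show ?thesis by (simp only: abs_mult mult.commute)
      qed
    qed
    moreover have "integral\<^sup>L lebesgue ?w = (M * integral\<^sup>L lebesgue g + M * pi) / sqrt b"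
    proof -
      have "integral\<^sup>L lebesgue ?w = M / b * (sqrt b * integral\<^sup>L lebesgue g +
          1 / sqrt b * (pi * b))"
        using g C b by (simp add: content_cball unit_ball_vol_2)
      also have "\<dots> = (M * integral\<^sup>L lebesgue g + M * pi) / sqrt b"
        using b by (simp add: field_simps) (simp add: algebra_simps flip: power2_eq_square)?
      finally show ?thesis .
    qed
    ultimately show "\<bar>LINT x|lebesgue. (u x - \<alpha> * ln (norm x)) * pderivative e ?\<phi> x\<bar> \<le>
        (M * integral\<^sup>L lebesgue g + M * pi) / sqrt b" by simp
  qed
qed

text \<open>Moving the centre along a coordinate direction, the average has as derivative the
  pairing of \<open>v\<close> with minus the derivative of the kernel, which the energy controls.
  The mean value inequality turns this into a bound for the difference.\<close>

lemma mollifier_translate_bound: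
  fixes c :: real
  obtains K where "\<And>b x0. b > 0 \<Longrightarrow> 1 + norm x0 + \<bar>c\<bar> < sqrt (b / 2) \<Longrightarrow> e \<in> Basis \<Longrightarrow>
     \<bar>(LINT x|lebesgue. (u x - \<alpha> * ln (max 1 (norm x))) * mollifier b (x0 + c *\<^sub>R e) x) -
      (LINT x|lebesgue. (u x - \<alpha> * ln (max 1 (norm x))) * mollifier b x0 x)\<bar> \<le> \<bar>c\<bar> * K / sqrt b"
proof -
  define v where "v x = u x - \<alpha> * ln (max 1 (norm x))" for x
  have v: "continuous_on UNIV v"
    unfolding v_def by (intro continuous_intros continuous_u continuous_on_ln_max_norm)
  obtain K where K: "\<And>b x0 e. b > 0 \<Longrightarrow> 1 + norm x0 < sqrt (b / 2) \<Longrightarrow> e \<in> Basis \<Longrightarrow>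
     \<bar>LINT x|lebesgue. (u x - \<alpha> * ln (norm x)) * pderivative e (mollifier b x0) x\<bar> \<le> K / sqrt b"
    using mollifier_energy_bound by blast
  show thesis
  proof
    fix b :: real and x0 :: "real ^ 2"
    assume b: "b > 0" and large: "1 + norm x0 + \<bar>c\<bar> < sqrt (b / 2)" and e: "e \<in> Basis"
    define p where "p t = x0 + t *\<^sub>R e" for t
    \<comment> \<open>The symmetric interval treats both signs of \<open>c\<close>; one box below
      contains the annuli for all \<open>t\<close> in it.\<close>
    define U where "U = {- \<bar>c\<bar>..\<bar>c\<bar>}"
    define d\<rho> where "d\<rho> = pderivative 1 (\<rho> b)"
    have norm_p: "norm (p t - x0) \<le> \<bar>c\<bar>" if "t \<in> U" for t
      using that e by (auto simp: p_def U_def)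
    obtain l m where lm: "cball x0 (sqrt b + \<bar>c\<bar>) \<subseteq> cbox l m" by (rule cball_subset_cbox)
    have in_cbox: "x \<in> cbox l m" if "t \<in> U" "norm (x - p t) < sqrt b" for t x
    proof -
      have "norm (x - x0) \<le> norm (x - p t) + norm (p t - x0)"
        using norm_triangle_ineq[of "x - p t" "p t - x0"] by simp
      then have "x \<in> cball x0 (sqrt b + \<bar>c\<bar>)"
        using that norm_p by (force simp: dist_norm norm_minus_commute)
      with lm show ?thesis by blast
    qed
    have \<rho>': "(\<rho> b has_real_derivative d\<rho> s) (at s)" for s
      unfolding d\<rho>_def by (rule C_k_SucD_real[OF C_k_\<rho>])
    have cont_d\<rho>: "continuous_on UNIV d\<rho>"
      unfolding d\<rho>_def by (rule C_k_0D[OF C_k_SucD_real(2)[OF C_k_\<rho>]])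
    have pd: "pderivative e (mollifier b y) x = 2 * ((x - y) \<bullet> e) * d\<rho> ((x - y) \<bullet> (x - y))" for x y
      by (subst pderivative_eqI[OF has_derivative_compose_dist_sq[OF \<rho>']]) simp
    have pd_support: "sqrt (b / 2) \<le> norm (x - y)" "norm (x - y) \<le> sqrt b"
      if "d\<rho> ((x - y) \<bullet> (x - y)) \<noteq> 0" for x y :: "real ^ 2"
    proof -
      let ?s = "(x - y) \<bullet> (x - y)"
      \<comment> \<open>Vanishing passes to the derivative on open sets. The value
        \<open>s = b\<close> is therefore left out, and the outer radius bound becomes
        non-strict.\<close>
      have zero: "d\<rho> s = 0" if "s \<in> {- (b / 2)<..<b / 2} \<union> {b<..}" for s
      proof -
        have "(\<rho> b has_real_derivative 0) (at s)"
          using DERIV_const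
          by (rule has_field_derivative_transform_within_open[where S="{- (b / 2)<..<b / 2} \<union>
              {b<..}" and f="\<lambda>_. 0"])
             (use that \<rho>_eq_0[OF b] in \<open>auto simp: abs_if\<close>)
        then show ?thesis using \<rho>' DERIV_unique by blast
      qed
      have "b / 2 \<le> (norm (x - y))\<^sup>2" "(norm (x - y))\<^sup>2 \<le> b"
        unfolding power2_norm_eq_inner using zero[of ?s] that b inner_ge_zero[of "x - y"] by force+
      then show "sqrt (b / 2) \<le> norm (x - y)" "norm (x - y) \<le> sqrt b"
        by (auto intro: real_le_lsqrt real_le_rsqrt)
    qed
    define h where "h t = integral (cbox l m) (\<lambda>x. v x * mollifier b (p t) x)" for t
    define h' where "h' t = integral (cbox l m) (\<lambda>x. v x * - pderivative e (mollifier b (p t)) x)"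
        for t
    have h_eq: "(LINT x|lebesgue. v x * mollifier b (p t) x) = h t" if "t \<in> U" for t
      unfolding h_def
    proof (rule continuous_compact_support_integrable(2))
      show "continuous_on UNIV (\<lambda>x. v x * mollifier b (p t) x)" by (intro continuous_intros v)
      show "x \<in> cbox l m" if "v x * mollifier b (p t) x \<noteq> 0" for x
        by (rule in_cbox[OF \<open>t \<in> U\<close> mollifier_support(2)[OF b]]) (use that in simp)
    qed
    have h'_bound: "\<bar>h' t\<bar> \<le> K / sqrt b" if t: "t \<in> U" for t
    proof -
      have "norm (p t) \<le> norm x0 + \<bar>c\<bar>"
        using norm_p[OF t] norm_triangle_sub[of "p t" x0] by linarith
      then have large': "1 + norm (p t) < sqrt (b / 2)" using large by linarith
      have "(LINT x|lebesgue. v x * - pderivative e (mollifier b (p t)) x) = h' t"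
        unfolding h'_def
      proof (rule continuous_compact_support_integrable(2))
        show "continuous_on UNIV (\<lambda>x. v x * - pderivative e (mollifier b (p t)) x)"
          unfolding pd by (intro continuous_intros v continuous_on_compose2[OF cont_d\<rho>]) auto
        show "x \<in> cbox l m" if "v x * - pderivative e (mollifier b (p t)) x \<noteq> 0" for x
        proof -
          have "norm (x - x0) \<le> norm (x - p t) + norm (p t - x0)"
            using norm_triangle_ineq[of "x - p t" "p t - x0"] by simp
          moreover have "norm (x - p t) \<le> sqrt b" using that by (intro pd_support(2)) (auto simp: pd)
          ultimately have "x \<in> cball x0 (sqrt b + \<bar>c\<bar>)"
            using norm_p[OF t] by (auto simp: dist_norm norm_minus_commute)
          with lm show ?thesis by blast
        qed
      qed
      moreover have "(\<lambda>x. v x * - pderivative e (mollifier b (p t)) x) =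
          (\<lambda>x. - ((u x - \<alpha> * ln (norm x)) * pderivative e (mollifier b (p t)) x))"
      proof
        fix x
        show "v x * - pderivative e (mollifier b (p t)) x =
          - ((u x - \<alpha> * ln (norm x)) * pderivative e (mollifier b (p t)) x)"
        \<comment> \<open>Where the derivative of the kernel is nonzero the point lies outside the
          unit disc, so both forms of the logarithm agree; elsewhere both sides are 0.\<close>
        proof (cases "d\<rho> ((x - p t) \<bullet> (x - p t)) = 0")
          case False
          have "norm x \<ge> 1"
            using pd_support(1)[OF False] large' norm_triangle_ineq4[of x "p t"] by linarith
          then show ?thesis by (simp add: v_def)
        qed (simp add: pd)
      qed
      ultimately have "h' t = - (LINT x|lebesgue. (u x -
          \<alpha> * ln (norm x)) * pderivative e (mollifier b (p t)) x)"
        by (simp only: Bochner_Integration.integral_minus)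
      then show ?thesis using K[OF b large' e] by (simp only: abs_minus_cancel)
    qed
    have deriv: "(h has_field_derivative h' t) (at t within U)" if "t \<in> U" for t
      unfolding h_def h'_def
    proof (rule leibniz_rule_field_derivative[where U=U])
      fix t x
      have "((\<lambda>t. (x - p t) \<bullet> (x - p t)) has_real_derivative - 2 * ((x - p t) \<bullet> e)) (at t)"
        unfolding has_field_derivative_def p_def
        by (auto intro!: derivative_eq_intros simp: inner_commute algebra_simps)
      from DERIV_chain2[OF \<rho>' this]
      have "((\<lambda>t. v x * mollifier b (p t) x) has_real_derivative v x * -
          pderivative e (mollifier b (p t)) x) (at t)"
        unfolding pd by (auto intro!: derivative_eq_intros)
      then show "((\<lambda>t. v x * mollifier b (p t) x) has_real_derivative v x * -
          pderivative e (mollifier b (p t)) x) (at t within U)"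
        by (rule has_field_derivative_at_within)
    next
      show "(\<lambda>x. v x * mollifier b (p t) x) integrable_on cbox l m" for t
        by (intro integrable_continuous continuous_intros continuous_on_subset[OF v]) auto
      show "continuous_on (U \<times> cbox l m) (\<lambda>(t, x). v x * - pderivative e (mollifier b (p t)) x)"
        unfolding pd p_def case_prod_beta
        by (intro continuous_intros continuous_on_compose2[OF cont_d\<rho>] continuous_on_compose2[OF
            v]) auto
    qed (use that in \<open>auto simp: U_def\<close>)
    have "norm (h c - h 0) \<le> K / sqrt b * norm (c - 0)"
      by (rule field_differentiable_bound[where S=U and f'=h'])
         (use deriv h'_bound in \<open>auto simp: U_def\<close>)
    then have "\<bar>h c - h 0\<bar> \<le> \<bar>c\<bar> * K / sqrt b" by (simp add: mult.commute)
    moreover have "c \<in> U" "0 \<in> U" by (auto simp: U_def)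
    ultimately show "\<bar>(LINT x|lebesgue. (u x - \<alpha> * ln (max 1 (norm x))) * mollifier b (x0 +
        c *\<^sub>R e) x) -
      (LINT x|lebesgue. (u x - \<alpha> * ln (max 1 (norm x))) * mollifier b x0 x)\<bar> \<le> \<bar>c\<bar> * K / sqrt b"
      using h_eq[of c] h_eq[of 0] by (simp add: v_def p_def)
  qed
qed

text \<open>The segment between the two centres is replaced by a path along coordinate directions,
  one translation bound per direction. The logarithm subtracted from \<open>u\<close> is added back
  through its own annular averages.\<close>

lemma mollified_diff_tendsto:
  "(\<lambda>n. (LINT x|lebesgue. u x * mollifier (real n) x0 x) -
        (LINT x|lebesgue. u x * mollifier (real n) x1 x)) \<longlonglongrightarrow> 0"
proof -
  define v where "v x = u x - \<alpha> * ln (max 1 (norm x))" for x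
  define V where "V n y = (LINT x|lebesgue. v x * mollifier (real n) y x)" for n y
  define W where "W n y = (LINT x|lebesgue. ln (max 1 (norm x)) * mollifier (real n) y x)" for n y
  have cont: "continuous_on UNIV v" "continuous_on UNIV (\<lambda>x::real ^ 2. ln (max 1 (norm x)))"
    unfolding v_def by (intro continuous_intros continuous_u continuous_on_ln_max_norm)+
  have step: "(\<lambda>n. V n (y + c *\<^sub>R e) - V n y) \<longlonglongrightarrow> 0" if "e \<in> Basis" for y c e
  proof -
    obtain K where K: "\<And>b x0. b > 0 \<Longrightarrow> 1 + norm x0 + \<bar>c\<bar> < sqrt (b / 2) \<Longrightarrow> e \<in> Basis \<Longrightarrow>
       \<bar>(LINT x|lebesgue. v x * mollifier b (x0 + c *\<^sub>R e) x) -
           (LINT x|lebesgue. v x * mollifier b x0 x)\<bar> \<le> \<bar>c\<bar> * K / sqrt b"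
      unfolding v_def by (rule mollifier_translate_bound) blast
    show ?thesis
    proof (rule Lim_null_comparison)
      have "\<forall>\<^sub>F n in sequentially. 1 + norm y + \<bar>c\<bar> < sqrt (real n / 2)" by real_asymp
      then show "\<forall>\<^sub>F n in sequentially. norm (V n (y + c *\<^sub>R e) - V n y) \<le> \<bar>c\<bar> * K / sqrt (real n)"
        using eventually_gt_at_top[of 0]
        by eventually_elim (use K that in \<open>auto simp: V_def\<close>)
      show "(\<lambda>n. \<bar>c\<bar> * K / sqrt (real n)) \<longlonglongrightarrow> 0" by real_asymp
    qed
  qed
  have "(\<lambda>n. V n (y + (\<Sum>e\<in>A. (z \<bullet> e) *\<^sub>R e)) - V n y) \<longlonglongrightarrow> 0"
    if "finite A" "A \<subseteq> Basis" for A and y z :: "real ^ 2"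
    using that
  proof (induction A arbitrary: y rule: finite_induct)
    case (insert a A)
    from tendsto_add[OF insert.IH[of "y + (z \<bullet> a) *\<^sub>R a"] step[of a y "z \<bullet> a"]] insert.prems
    show ?case by (simp add: insert.hyps add_ac)
  qed simp
  from this[of Basis x1 "x0 - x1"] have V: "(\<lambda>n. V n x0 - V n x1) \<longlonglongrightarrow> 0"
    by (simp add: euclidean_representation)
  have U: "(LINT x|lebesgue. u x * mollifier (real n) y x) = V n y + \<alpha> * W n y" if "n > 0" for n y
  proof -
    note i = integrable_mult_mollifier[OF _ cont(1), of
        "real n" y] integrable_mult_mollifier[OF _ cont(2), of "real n" y]
    have "(LINT x|lebesgue. u x * mollifier (real n) y x) =
        (LINT x|lebesgue. v x * mollifier (real n) y x +
            \<alpha> * (ln (max 1 (norm x)) * mollifier (real n) y x))"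
      by (intro Bochner_Integration.integral_cong) (auto simp: v_def algebra_simps)
    then show ?thesis using that i by (simp add: V_def W_def)
  qed
  have "(\<lambda>n. (V n x0 - V n x1) + \<alpha> * (W n x0 - W n x1)) \<longlonglongrightarrow> 0 + \<alpha> * 0"
    using V ln_mollifier_diff_tendsto unfolding W_def
        by (intro tendsto_add tendsto_mult tendsto_const)
  moreover have "\<forall>\<^sub>F n in sequentially. (V n x0 - V n x1) + \<alpha> * (W n x0 - W n x1) =
      (LINT x|lebesgue. u x * mollifier (real n) x0 x) -
          (LINT x|lebesgue. u x * mollifier (real n) x1 x)"
    using eventually_gt_at_top[of 0] by eventually_elim (simp only: U, simp add: right_diff_distrib)
  ultimately show ?thesis using tendsto_cong by fastforce
qed

text \<open>Rests on \<open>norm (y - x) \<le> max 1 (norm (y - z)) * (1 + norm (x - z))\<close>.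
  The bound has two integrable singularities and a constant, so the kernel difference is integrable
  against \<open>f\<close> without any moment condition.\<close>

lemma abs_ln_norm_diff_le:
  fixes x y z :: "'a::real_normed_vector"
  assumes "y \<noteq> x" "y \<noteq> z"
  shows "\<bar>ln (norm (y - x)) - ln (norm (y - z))\<bar> \<le>
    max 0 (ln (1 / norm (y - x))) + max 0 (ln (1 / norm (y - z))) + ln (1 + norm (x - z))"
proof -
  have *: "ln (norm (y - x)) \<le> ln (norm (y - z)) + max 0 (ln (1 / norm (y - z))) +
      ln (1 + norm (x - z))"
    if "y \<noteq> x" "y \<noteq> z" for x z
  proof -
    define d where "d = norm (x - z)"
    have d: "d \<ge> 0" by (simp add: d_def)
    have "norm (y - x) \<le> norm (y - z) + d"
      unfolding d_def using norm_triangle_ineq4[of "y - z" "x - z"] by simp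
    also have "\<dots> \<le> max 1 (norm (y - z)) * (1 + d)"
    proof -
      have "norm (y - z) \<le> max 1 (norm (y - z))" "d \<le> max 1 (norm (y - z)) * d"
        using d mult_right_mono[of 1 "max 1 (norm (y - z))" d] by auto
      then show ?thesis by (simp add: algebra_simps)
    qed
    finally have "ln (norm (y - x)) \<le> ln (max 1 (norm (y - z)) * (1 + d))"
      using that by (intro ln_mono) auto
    also have "\<dots> = ln (max 1 (norm (y - z))) + ln (1 + d)"
      using d by (subst ln_mult) auto
    also have "ln (max 1 (norm (y - z))) = ln (norm (y - z)) + max 0 (ln (1 / norm (y - z)))"
      using that by (auto simp: max_def ln_div)
    finally show ?thesis by (simp add: d_def)
  qed
  from *[OF assms] *[OF assms(2,1)] show ?thesis
    unfolding norm_minus_commute[of z x] by linarith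
qed

lemma f_ln_diff_integrable:
  "integrable lebesgue (\<lambda>y. f y * (ln (norm (y - x0)) - ln (norm (y - x1))))"
proof (rule Bochner_Integration.integrable_bound)
  show "integrable lebesgue (\<lambda>y. f y * max 0 (ln (1 / norm (y - x0))) +
      f y * max 0 (ln (1 / norm (y - x1)))
      + f y * ln (1 + norm (x0 - x1)))"
    by (intro Bochner_Integration.integrable_add integrable_mult_left f_integrable
        f_ln_pos_integrable) auto
  have [measurable]: "(\<lambda>y. ln (norm (y - x0)) - ln (norm (y - x1))) \<in> borel_measurable lebesgue"
    by (intro measurable_completion) measurable
  show "(\<lambda>y. f y * (ln (norm (y - x0)) - ln (norm (y - x1)))) \<in> borel_measurable lebesgue"
      by measurable
  show "AE y in lebesgue. norm (f y * (ln (norm (y - x0)) - ln (norm (y - x1)))) \<le>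
      norm (f y * max 0 (ln (1 / norm (y - x0))) + f y * max 0 (ln (1 / norm (y - x1))) +
          f y * ln (1 + norm (x0 - x1)))"
    using AE_lebesgue_neq[of x0] AE_lebesgue_neq[of x1]
  proof eventually_elim
    case (elim y)
    from mult_left_mono[OF abs_ln_norm_diff_le[OF elim] f_nonneg[of y]]
    show ?case using f_nonneg[of y] by (simp add: abs_mult distrib_left)
  qed
qed

text \<open>Subtracting the local representations at two centres removes the annular averages in the
  limit. The individual potentials need not converge, but their difference does: for fixed
  \<open>y\<close> both arguments of \<open>L\<close> eventually fall below 1/2, where
  \<open>L\<close> is exactly a logarithm up to a constant.\<close>

theorem representation:
  "u x0 - u x1 = 1 / (2 * pi) * (LINT y|lebesgue. f y * (ln (norm (y - x0)) - ln (norm (y - x1))))"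
proof -
  define N where "N x y = (y - x) \<bullet> (y - x)" for x y :: "real ^ 2"
  have N_pos: "N x y > 0" if "y \<noteq> x" for x y using that by (simp add: N_def)
  have ln_N: "ln (N x y) = 2 * ln (norm (y - x))" if "y \<noteq> x" for x y
    using that by (simp add: N_def dot_square_norm ln_realpow)
  let ?D = "\<lambda>y. ln (norm (y - x0)) - ln (norm (y - x1))"
  have [measurable]: "(\<lambda>y. L (N x y / b)) \<in> borel_measurable lebesgue" for x b
    unfolding N_def by (intro measurable_completion) measurable
  have lim: "(\<lambda>n. LINT y|lebesgue. f y * (L (N x0 y / real n) - L (N x1 y / real n)))
      \<longlonglongrightarrow> (LINT y|lebesgue. f y * (?D y / (2 * pi)))"
  proof (rule integral_dominated_convergence[where w="\<lambda>y. f y * \<bar>?D y\<bar> / (2 * pi)"])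
    have "integrable lebesgue (\<lambda>y. \<bar>f y * ?D y\<bar>)"
      using f_ln_diff_integrable by (rule integrable_abs)
    then show "integrable lebesgue (\<lambda>y. f y * \<bar>?D y\<bar> / (2 * pi))"
      using f_nonneg by (simp add: abs_mult)
    show "AE y in lebesgue. (\<lambda>n. f y * (L (N x0 y / real n) - L (N x1 y / real n))) \<longlonglongrightarrow>
        f y * (?D y / (2 * pi))"
      using AE_lebesgue_neq[of x0] AE_lebesgue_neq[of x1]
    proof eventually_elim
      case (elim y)
      have "\<forall>\<^sub>F n in sequentially. N x y / real n < 1 / 2" for x by real_asymp
      from this[of x0] this[of x1] eventually_gt_at_top[of 0]
      have "\<forall>\<^sub>F n in sequentially. f y * (L (N x0 y / real n) - L (N x1 y / real n)) =
          f y * (?D y / (2 * pi))"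
      proof eventually_elim
        case (elim n)
        have n: "0 < N x0 y / real n" "0 < N x1 y / real n"
          using N_pos \<open>y \<noteq> x0\<close> \<open>y \<noteq> x1\<close> elim by auto
        have "L (N x0 y / real n) - L (N x1 y / real n) =
            (ln (N x0 y / real n) - ln (N x1 y / real n)) / (4 * pi)"
          using L_diff_small[OF n(1) _ elim(2)] L_diff_small[OF n(2) _ elim(1)]
          by (cases "N x0 y / real n \<le> N x1 y / real n") (auto simp: field_simps)
        also have "\<dots> = ?D y / (2 * pi)"
          using N_pos[OF \<open>y \<noteq> x0\<close>] N_pos[OF \<open>y \<noteq> x1\<close>] \<open>y \<noteq> x0\<close> \<open>y \<noteq> x1\<close> elim
          by (simp add: ln_div ln_N) (simp add: field_simps)
        finally show ?case by simp
      qed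
      then show ?case by (rule tendsto_eventually)
    qed
    show "AE y in lebesgue. norm (f y * (L (N x0 y / real n) - L (N x1 y / real n))) \<le>
        f y * \<bar>?D y\<bar> / (2 * pi)" for n
      using AE_lebesgue_neq[of x0] AE_lebesgue_neq[of x1]
    proof eventually_elim
      case (elim y)
      have "\<bar>L (N x0 y / real n) - L (N x1 y / real n)\<bar> \<le> \<bar>?D y\<bar> / (2 * pi)"
      \<comment> \<open>For \<open>n = 0\<close> division by zero makes both arguments of
        \<open>L\<close> equal to 0.\<close>
      proof (cases "n = 0")
        case False
        then have n: "0 < N x0 y / real n" "0 < N x1 y / real n"
          using N_pos elim by auto
        have "\<bar>L (N x0 y / real n) - L (N x1 y / real n)\<bar> \<le>
            \<bar>ln (N x0 y / real n) - ln (N x1 y / real n)\<bar> / (4 * pi)"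
          by (rule abs_L_diff_le[OF n])
        also have "ln (N x0 y / real n) - ln (N x1 y / real n) = 2 * ?D y"
          using N_pos[OF elim(1)] N_pos[OF elim(2)] elim False by (simp add: ln_div ln_N)
        also have "\<bar>2 * ?D y\<bar> / (4 * pi) = \<bar>?D y\<bar> / (2 * pi)" by (simp only: abs_mult)
        finally show ?thesis .
      qed simp
      from mult_left_mono[OF this f_nonneg[of y]] show ?case
        using f_nonneg[of y] by (simp add: abs_mult)
    qed
  qed (use borel_measurable_integrable[OF f_ln_diff_integrable[of x0 x1]] in auto)
  have eq: "\<forall>\<^sub>F n in sequentially. (LINT y|lebesgue. f y * (L (N x0 y / real n) -
      L (N x1 y / real n))) =
      (u x0 - u x1) - ((LINT x|lebesgue. u x * mollifier (real n) x0 x) -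
          (LINT x|lebesgue. u x * mollifier (real n) x1 x))"
    using eventually_gt_at_top[of 0]
  proof eventually_elim
    case (elim n)
    then show ?case
      using local_representation[of "real n" x0] local_representation[of "real n" x1]
        f_L_integrable[of "real n" x0] f_L_integrable[of "real n" x1]
      by (simp add: N_def right_diff_distrib)
  qed
  have "(\<lambda>n. (u x0 - u x1) - ((LINT x|lebesgue. u x * mollifier (real n) x0 x) -
      (LINT x|lebesgue. u x * mollifier (real n) x1 x)))
      \<longlonglongrightarrow> (u x0 - u x1) - 0"
    by (intro tendsto_diff tendsto_const mollified_diff_tendsto)
  from LIMSEQ_unique[OF this iffD1[OF tendsto_cong[OF eq] lim]]
  have "(LINT y|lebesgue. f y * (?D y / (2 * pi))) = u x0 - u x1" by simp
  then show ?thesis by simp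
qed

end

subsection \<open>Asymptotics of the logarithmic potential\<close>

text \<open>Dominated convergence is applied along sequences; this transfers the result to the
  filter at infinity.\<close>

lemma tendsto_at_infinity_sequentiallyI:
  fixes F :: "'a::real_normed_vector \<Rightarrow> 'b::metric_space"
  assumes "\<And>X. (\<And>n. norm (X n) \<ge> real (Suc n)) \<Longrightarrow> (\<lambda>n. F (X n)) \<longlonglongrightarrow> c"
  shows "(F \<longlongrightarrow> c) at_infinity"
proof (rule ccontr)
  assume "\<not> ?thesis"
  then obtain e where e: "e > 0" "\<not> (\<forall>\<^sub>F x in at_infinity. dist (F x) c < e)"
    unfolding tendsto_iff by blast
  then have "\<exists>x. norm x \<ge> real (Suc n) \<and> dist (F x) c \<ge> e" for n
    unfolding eventually_at_infinity by (meson not_less)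
  then obtain X where X: "\<And>n. norm (X n) \<ge> real (Suc n)" "\<And>n. dist (F (X n)) c \<ge> e" by metis
  from tendstoD[OF assms[OF X(1)] e(1)] obtain n where "dist (F (X n)) c < e"
    by (auto simp: eventually_sequentially)
  with X(2)[of n] show False by simp
qed

context planar_solution
begin

definition near_potential :: "real ^ 2 \<Rightarrow> real" where
  "near_potential x = 1 / (2 * pi) * (LINT y|lebesgue. f y * max 0 (ln (1 / norm (y - x))))"

lemma near_potential_nonneg: "0 \<le> near_potential x"
  unfolding near_potential_def using f_nonneg
  by (intro mult_nonneg_nonneg integral_nonneg_AE) auto

text \<open>For \<open>1 \<le> norm y\<close> one has
  \<open>norm (y - x) \<le> norm y * (1 + norm x)\<close>, so the kernel based at 0 is at most
  \<open>ln (1 + norm x)\<close>. Only the total mass of \<open>f\<close> enters, which makes this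
  the a priori bound from which the estimates of \<open>f\<close> start.\<close>

lemma solution_upper_bound:
  assumes mass: "integral\<^sup>L lebesgue f = 2 * pi * \<alpha>" and supp: "\<And>y. f y \<noteq> 0 \<Longrightarrow> 1 \<le> norm y"
  shows "u x \<le> u 0 + \<alpha> * ln (1 + norm x)"
proof -
  have "(LINT y|lebesgue. f y * (ln (norm (y - x)) - ln (norm (y - 0)))) \<le>
      (LINT y|lebesgue. f y * ln (1 + norm x))"
  proof (rule integral_mono[OF f_ln_diff_integrable])
    show "integrable lebesgue (\<lambda>y. f y * ln (1 + norm x))"
      by (intro integrable_mult_left f_integrable)
    fix y
    show "f y * (ln (norm (y - x)) - ln (norm (y - 0))) \<le> f y * ln (1 + norm x)"
    proof (cases "f y = 0")
      case False
      then have y: "1 \<le> norm y" by (rule supp)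
      have "ln (norm (y - x)) \<le> ln (norm y) + ln (1 + norm x)"
      proof (cases "y = x")
        case False
        have "norm (y - x) \<le> norm y + norm x" by (rule norm_triangle_ineq4)
        also have "\<dots> \<le> norm y * (1 + norm x)"
          using mult_right_mono[OF y, of "norm x"] by (simp add: algebra_simps)
        finally have "ln (norm (y - x)) \<le> ln (norm y * (1 + norm x))"
          using False by (intro ln_mono) auto
        also have "\<dots> = ln (norm y) + ln (1 + norm x)"
          using y norm_ge_zero[of x] by (intro ln_mult_pos) linarith+
        finally show ?thesis .
      qed (use y in simp)
      then show ?thesis using f_nonneg[of y] by (intro mult_left_mono) auto
    qed simp
  qed
  also have "\<dots> = 2 * pi * \<alpha> * ln (1 + norm x)" using mass by simp
  finally have "(LINT y|lebesgue. f y * (ln (norm (y - x)) - ln (norm (y - 0)))) / (2 * pi) \<le>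
      2 * pi * \<alpha> * ln (1 + norm x) / (2 * pi)"
    by (intro divide_right_mono) auto
  then show ?thesis using representation[of x 0] by simp
qed

text \<open>The logarithmic singularity is the only obstruction to convergence: replacing \<open>ln |y - x|\<close>
  by \<open>ln (max 1 |y - x|)\<close> makes the kernel, minus \<open>ln |x|\<close>, bounded by \<open>ln (1 + |y|)\<close>.\<close>

lemma solution_asymptotics:
  assumes mass: "integral\<^sup>L lebesgue f = 2 * pi * \<alpha>" and supp: "\<And>y. f y \<noteq> 0 \<Longrightarrow> 1 \<le> norm y"
    and moment: "integrable lebesgue (\<lambda>y. f y * ln (norm y))"
  shows "\<exists>C. ((\<lambda>x. u x - \<alpha> * ln (norm x) + near_potential x) \<longlongrightarrow> C) at_infinity"
proof -
  define R where "R x = (LINT y|lebesgue. f y * (ln (max 1 (norm (y - x))) - ln (norm x)))" for x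
  have kernel: "\<bar>ln (max 1 (norm (y - x))) - ln (norm x)\<bar> \<le> ln (1 + norm y)" if x: "norm x \<ge> 1"
      for x y :: "real ^ 2"
  proof -
    have m: "max 1 (norm (y - x)) > 0" by (simp add: less_max_iff_disj)
    have "max 1 (norm (y - x)) \<le> norm x * (1 + norm y)"
    proof -
      have "norm (y - x) \<le> norm y + norm x" by (rule norm_triangle_ineq4)
      moreover have "norm y \<le> norm x * norm y" using mult_right_mono[OF x, of "norm y"] by simp
      moreover have "0 \<le> norm x * norm y" by simp
      ultimately show ?thesis
        unfolding distrib_left mult_1_right max.bounded_iff using x by linarith
    qed
    then have "ln (max 1 (norm (y - x))) \<le> ln (norm x * (1 + norm y))" using m by (rule ln_mono)
    also have "\<dots> = ln (norm x) + ln (1 + norm y)"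
      using x norm_ge_zero[of y] by (intro ln_mult_pos) linarith+
    finally have 1: "ln (max 1 (norm (y - x))) \<le> ln (norm x) + ln (1 + norm y)" .
    have "norm x \<le> max 1 (norm (y - x)) * (1 + norm y)"
    proof -
      have "norm x \<le> norm y + norm (y - x)" using norm_triangle_sub[of x y]
          by (simp add: norm_minus_commute)
      moreover have "norm y \<le> max 1 (norm (y - x)) * norm y"
        using mult_right_mono[of 1 "max 1 (norm (y - x))" "norm y"] by simp
      ultimately show ?thesis by (simp add: algebra_simps)
    qed
    then have "ln (norm x) \<le> ln (max 1 (norm (y - x)) * (1 + norm y))" using x
        by (intro ln_mono) linarith+
    also have "\<dots> = ln (max 1 (norm (y - x))) + ln (1 + norm y)"
      using m norm_ge_zero[of y] by (intro ln_mult_pos) linarith+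
    finally show ?thesis using 1 by linarith
  qed
  have bound: "f y * ln (1 + norm y) \<le> f y * ln 2 + f y * ln (norm y)" for y
  proof (cases "f y = 0")
    case False
    then have "1 \<le> norm y" by (rule supp)
    then have "ln (1 + norm y) \<le> ln (2 * norm y)" by (intro ln_mono) linarith+
    also have "\<dots> = ln 2 + ln (norm y)" using \<open>1 \<le> norm y\<close> by (intro ln_mult_pos) linarith+
    finally have "f y * ln (1 + norm y) \<le> f y * (ln 2 + ln (norm y))"
      using f_nonneg[of y] by (rule mult_left_mono)
    then show ?thesis by (simp add: algebra_simps)
  qed simp
  have R_bound: "\<bar>f y * (ln (max 1 (norm (y - x))) - ln (norm x))\<bar> \<le> f y * ln 2 + f y * ln (norm y)"
    if "norm x \<ge> 1" for x y
    using mult_left_mono[OF kernel[OF that] f_nonneg[of y], of y] bound[of y] f_nonneg[of y]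
    by (simp add: abs_mult)
  have w: "integrable lebesgue (\<lambda>y. f y * ln 2 + f y * ln (norm y))"
    by (intro Bochner_Integration.integrable_add integrable_mult_left f_integrable moment)
  have [measurable]: "(\<lambda>y. ln (max 1 (norm (y - x))) - ln (norm x)) \<in> borel_measurable lebesgue"
      for x :: "real ^ 2"
    by (intro measurable_completion) measurable
  have "(R \<longlongrightarrow> 0) at_infinity"
  proof (rule tendsto_at_infinity_sequentiallyI)
    fix X :: "nat \<Rightarrow> real ^ 2" assume X: "\<And>n. norm (X n) \<ge> real (Suc n)"
    then have X1: "norm (X n) \<ge> 1" for n
    using X[of n] of_nat_0_le_iff[of n, where 'a=real] unfolding of_nat_Suc by linarith
    have "(\<lambda>n. R (X n)) \<longlonglongrightarrow> integral\<^sup>L lebesgue (\<lambda>y :: real ^ 2. 0)"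
      unfolding R_def
    proof (rule integral_dominated_convergence[where w="\<lambda>y. f y * ln 2 + f y * ln (norm y)"])
      show "AE y in lebesgue. (\<lambda>n. f y * (ln (max 1 (norm (y - X n))) - ln (norm (X n)))) \<longlonglongrightarrow> 0"
      proof (rule AE_I2)
        fix y
        have "(\<lambda>n. max 1 (norm (y - X n)) / norm (X n)) \<longlonglongrightarrow> 1"
        proof (rule Lim_null_comparison[THEN LIM_zero_cancel])
          show "\<forall>\<^sub>F n in sequentially. norm (max 1 (norm (y - X n)) / norm (X n) - 1) \<le>
              (1 + norm y) / real (Suc n)"
          proof (rule always_eventually, rule allI)
            fix n
            have "norm (y - X n) \<le> norm y + norm (X n)" "norm (X n) \<le> norm y + norm (y - X n)"
              using norm_triangle_sub[of "X n" y] norm_triangle_ineq4[of y "X n"]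
              by (simp_all add: norm_minus_commute)
            then have "\<bar>max 1 (norm (y - X n)) - norm (X n)\<bar> \<le> 1 + norm y"
              using X1[of n] norm_ge_zero[of y] by (simp add: abs_le_iff max_def split: if_splits)
            then have "\<bar>max 1 (norm (y - X n)) - norm (X n)\<bar> / norm (X n) \<le>
                (1 + norm y) / real (Suc n)"
              using X[of n] by (intro frac_le) auto
            moreover have "max 1 (norm (y - X n)) / norm (X n) - 1 =
                (max 1 (norm (y - X n)) - norm (X n)) / norm (X n)"
              using X1[of n] by (auto simp: diff_divide_distrib)
            ultimately show "norm (max 1 (norm (y - X n)) / norm (X n) - 1) \<le>
                (1 + norm y) / real (Suc n)"
              by simp
          qed
          show "(\<lambda>n. (1 + norm y) / real (Suc n)) \<longlonglongrightarrow> 0" by real_asymp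
        qed
        from tendsto_ln[OF this]
        have "(\<lambda>n. ln (max 1 (norm (y - X n)) / norm (X n))) \<longlonglongrightarrow> 0" by simp
        moreover have "ln (max 1 (norm (y - X n)) / norm (X n)) =
            ln (max 1 (norm (y - X n))) - ln (norm (X n))" for n
          using X1[of n] by (auto simp: ln_div max_def)
        ultimately have "(\<lambda>n. ln (max 1 (norm (y - X n))) - ln (norm (X n))) \<longlonglongrightarrow> 0" by simp
        from tendsto_mult_left[OF this, of "f y"]
        show "(\<lambda>n. f y * (ln (max 1 (norm (y - X n))) - ln (norm (X n)))) \<longlonglongrightarrow> 0" by simp
      qed
      show "AE y in lebesgue. norm (f y * (ln (max 1 (norm (y - X n))) - ln (norm (X n)))) \<le>
          f y * ln 2 + f y * ln (norm y)" for n
        using R_bound[OF X1] by simp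
      show "(\<lambda>y. f y * (ln (max 1 (norm (y - X n))) -
          ln (norm (X n)))) \<in> borel_measurable lebesgue" for n
        by measurable
    qed (use w in auto)
    then show "(\<lambda>n. R (X n)) \<longlonglongrightarrow> 0" by simp
  qed
  \<comment> \<open>The limit is explicit: representing \<open>u\<close> relative to the origin
    leaves \<open>u 0\<close> minus the potential at the origin, finite by
    \<open>moment\<close>.\<close>
  define C where "C = u 0 - 1 / (2 * pi) * (LINT y|lebesgue. f y * ln (norm y))"
  have eq: "u x - \<alpha> * ln (norm x) + near_potential x = C + 1 / (2 * pi) * R x" if "norm x \<ge> 1" for x
  proof -
    have i1: "integrable lebesgue (\<lambda>y. f y * max 0 (ln (1 / norm (y - x))))"
      by (rule f_ln_pos_integrable) simp
    have i2: "integrable lebesgue (\<lambda>y. f y * ln (norm x))"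
      by (intro integrable_mult_left f_integrable)
    have "R x = (LINT y|lebesgue. f y * (ln (norm (y - x)) - ln (norm (y - 0))) +
        f y * max 0 (ln (1 / norm (y - x))) + f y * ln (norm y) - f y * ln (norm x))"
      unfolding R_def
    proof (rule integral_cong_AE)
      show "AE y in lebesgue. f y * (ln (max 1 (norm (y - x))) - ln (norm x)) =
          f y * (ln (norm (y - x)) - ln (norm (y - 0))) + f y * max 0 (ln (1 / norm (y - x))) +
              f y * ln (norm y) - f y * ln (norm x)"
        using AE_lebesgue_neq[of x]
      proof eventually_elim
        case (elim y)
        have "ln (max 1 (norm (y - x))) = ln (norm (y - x)) + max 0 (ln (1 / norm (y - x)))"
          using elim by (auto simp: max_def ln_div)
        then show ?case by (simp add: algebra_simps)
      qed
      show "(\<lambda>y. f y * (ln (norm (y - x)) - ln (norm (y - 0))) +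
          f y * max 0 (ln (1 / norm (y - x))) + f y * ln (norm y) -
          f y * ln (norm x)) \<in> borel_measurable lebesgue"
        by (intro borel_measurable_integrable Bochner_Integration.integrable_diff
            Bochner_Integration.integrable_add
            f_ln_diff_integrable i1 i2 moment)
    qed measurable
    also have "\<dots> = (LINT y|lebesgue. f y * (ln (norm (y - x)) - ln (norm (y - 0)))) +
        (LINT y|lebesgue. f y * max 0 (ln (1 / norm (y - x)))) +
            (LINT y|lebesgue. f y * ln (norm y)) -
        (LINT y|lebesgue. f y * ln (norm x))"
      using f_ln_diff_integrable[of x 0] i1 i2 moment
      by (simp only: Bochner_Integration.integral_diff Bochner_Integration.integral_add
          Bochner_Integration.integrable_diff Bochner_Integration.integrable_add)
    also have "(LINT y|lebesgue. f y * ln (norm x)) = 2 * pi * \<alpha> * ln (norm x)"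
      using mass by simp
    finally show ?thesis
      using representation[of x 0] by (simp add: C_def near_potential_def field_simps)
  qed
  have "((\<lambda>x. C + 1 / (2 * pi) * R x) \<longlongrightarrow> C + 1 / (2 * pi) * 0) at_infinity"
    by (intro tendsto_intros \<open>(R \<longlongrightarrow> 0) at_infinity\<close>)
  moreover have "\<forall>\<^sub>F x in at_infinity. C + 1 / (2 * pi) * R x =
      u x - \<alpha> * ln (norm x) + near_potential x"
    unfolding eventually_at_infinity using eq by (intro exI[of _ 1]) auto
  ultimately have "((\<lambda>x. u x - \<alpha> * ln (norm x) + near_potential x) \<longlongrightarrow> C) at_infinity"
    using tendsto_cong by fastforce
  then show ?thesis by blast
qed

end

subsection \<open>The coefficient \<open>K\<^sub>0\<close>\<close>

lemma bump_center_eq: "bump_center n = real n *\<^sub>R axis 1 1"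
  by (simp add: bump_center_def vec_eq_iff forall_2 vector_2 axis_def)

lemma norm_bump_center [simp]: "norm (bump_center n) = real n"
  by (simp add: bump_center_eq)

lemma dist_bump_center: "dist (bump_center m) (bump_center n) = \<bar>real m - real n\<bar>"
  by (simp add: bump_center_eq dist_norm scaleR_left_diff_distrib[symmetric])

lemma bump_radius_pos [simp]: "0 < bump_radius q n"
  by (simp add: bump_radius_def)

lemma bump_radius_powr: "bump_radius q n powr (-2) = 1 / (bump_radius q n)\<^sup>2"
  using bump_radius_pos[of q n] by (simp add: powr_minus inverse_eq_divide powr_realpow[of _ 2,
      simplified])

lemma norm_rescaled_bump:
  "norm ((x - bump_center n) /\<^sub>R bump_radius q n) = dist (bump_center n) x / bump_radius q n"
  by (simp add: dist_norm norm_minus_commute divide_inverse mult.commute abs_of_pos)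

lemma bump_radius_less_half:
  assumes "1 < q" "2 \<le> n"
  shows "bump_radius q n < 1 / 2"
proof -
  have "real n powr 1 \<le> real n powr q" using assms by (intro powr_mono) auto
  then have "2 \<le> real n powr q" using assms by simp
  then have "3 \<le> exp (real n powr q)"
    using exp_ge_add_one_self[of "real n powr q"] by linarith
  then show ?thesis by (simp add: bump_radius_def exp_minus field_simps)
qed

lemma in_bump_norm:
  assumes "1 < q" "2 \<le> n" "y \<in> ball (bump_center n) (bump_radius q n)"
  shows "norm y \<le> real n + 1 / 2" "real n - 1 / 2 \<le> norm y"
proof -
  have "norm (y - bump_center n) < 1 / 2"
    using assms(3) bump_radius_less_half[OF assms(1,2)] by (simp add: dist_norm norm_minus_commute)
  then show "norm y \<le> real n + 1 / 2" "real n - 1 / 2 \<le> norm y"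
    using norm_triangle_sub[of y "bump_center n"] norm_triangle_sub[of "bump_center n" y]
    by (simp_all add: norm_minus_commute)
qed

text \<open>Centres are integers on an axis and all radii are below 1/2. Hence the infinite sum
  defining \<open>K\<^sub>0\<close> has at most one nonzero term at each point.\<close>

lemma bumps_disjoint:
  assumes "1 < q" "2 \<le> m" "2 \<le> n" "x \<in> ball (bump_center m) (bump_radius q m)"
    and "x \<in> ball (bump_center n) (bump_radius q n)"
  shows "m = n"
proof -
  have "\<bar>real m - real n\<bar> < 1"
    unfolding dist_bump_center[symmetric]
    using dist_triangle2[of "bump_center m" "bump_center n" x] assms(4,5)
      bump_radius_less_half[OF assms(1,2)] bump_radius_less_half[OF assms(1,3)]
    by (simp add: dist_commute)
  then show ?thesis by linarith
qed

locale bump_profile =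
  fixes \<eta> :: "real ^ 2 \<Rightarrow> real" and l q :: real
  assumes q: "1 < q"
    and \<eta>_ge: "\<And>x. indicator (ball 0 (1/2)) x \<le> \<eta> x"
    and \<eta>_le: "\<And>x. \<eta> x \<le> indicator (ball 0 1) x"
begin

abbreviation bump :: "nat \<Rightarrow> (real ^ 2) set" where
  "bump n \<equiv> ball (bump_center n) (bump_radius q n)"

lemma \<eta>_nonneg: "0 \<le> \<eta> x"
  using \<eta>_ge[of x] by (rule order_trans[rotated]) auto

lemma \<eta>_le_1: "\<eta> x \<le> 1"
  using \<eta>_le[of x] by (rule order_trans) (auto split: split_indicator)

lemma \<eta>_outside:
  assumes "x \<notin> bump n"
  shows "\<eta> ((x - bump_center n) /\<^sub>R bump_radius q n) = 0"
proof -
  have "(x - bump_center n) /\<^sub>R bump_radius q n \<notin> ball 0 1"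
    using assms by (simp add: norm_rescaled_bump not_less del: norm_scaleR)
  with \<eta>_le[of "(x - bump_center n) /\<^sub>R bump_radius q n"]
    \<eta>_nonneg[of "(x - bump_center n) /\<^sub>R bump_radius q n"]
  show ?thesis by (simp del: mem_ball)
qed

lemma \<eta>_inside:
  assumes "x \<in> ball (bump_center n) (bump_radius q n / 2)"
  shows "\<eta> ((x - bump_center n) /\<^sub>R bump_radius q n) = 1"
proof -
  have "(x - bump_center n) /\<^sub>R bump_radius q n \<in> ball 0 (1/2)"
    using assms by (simp add: norm_rescaled_bump divide_less_eq del: norm_scaleR)
  with \<eta>_ge[of "(x - bump_center n) /\<^sub>R bump_radius q n"]
    \<eta>_le_1[of "(x - bump_center n) /\<^sub>R bump_radius q n"]
  show ?thesis by (simp del: mem_ball)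
qed

lemma K\<^sub>0_in_bump:
  assumes "2 \<le> n" "x \<in> bump n"
  shows "K\<^sub>0 \<eta> l q x = - (bump_radius q n powr (-2) * real n powr (- l) *
    \<eta> ((x - bump_center n) /\<^sub>R bump_radius q n))"
proof -
  have "(\<Sum>\<^sub>\<infinity>m\<in>{2..}. bump_radius q m powr (-2) * real m powr (- l) *
        \<eta> ((x - bump_center m) /\<^sub>R bump_radius q m)) =
      (\<Sum>\<^sub>\<infinity>m\<in>{n}. bump_radius q m powr (-2) * real m powr (- l) *
        \<eta> ((x - bump_center m) /\<^sub>R bump_radius q m))"
  proof (rule infsum_cong_neutral)
    fix m assume m: "m \<in> {2..} - {n}"
    then have "x \<notin> bump m" using bumps_disjoint[OF q _ assms(1) _ assms(2), of m] by auto
    from \<eta>_outside[OF this]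
    show "bump_radius q m powr (-2) * real m powr (- l) * \<eta> ((x -
        bump_center m) /\<^sub>R bump_radius q m) = 0"
      by simp
  qed (use assms in auto)
  then show ?thesis by (simp add: K\<^sub>0_def)
qed

lemma K\<^sub>0_outside_bumps:
  assumes "\<And>n. 2 \<le> n \<Longrightarrow> x \<notin> bump n"
  shows "K\<^sub>0 \<eta> l q x = 0"
  unfolding K\<^sub>0_def using assms by (subst infsum_0) (auto simp: \<eta>_outside simp del: mem_ball)

lemma K\<^sub>0_cases:
  obtains "K\<^sub>0 \<eta> l q x = 0"
  | n where "2 \<le> n" "x \<in> bump n"
    "K\<^sub>0 \<eta> l q x \<le> 0" "- K\<^sub>0 \<eta> l q x \<le> 1 / (bump_radius q n)\<^sup>2 * real n powr (- l)"
proof (cases "\<exists>n\<ge>2. x \<in> bump n")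
  case True
  then obtain n where n: "2 \<le> n" "x \<in> bump n" by blast
  let ?e = "\<eta> ((x - bump_center n) /\<^sub>R bump_radius q n)"
  have "bump_radius q n powr (-2) * real n powr (- l) * ?e \<le>
      bump_radius q n powr (-2) * real n powr (- l) * 1"
    using \<eta>_le_1 by (intro mult_left_mono) auto
  then show ?thesis
    using that(2)[OF n] K\<^sub>0_in_bump[OF n] \<eta>_nonneg by (simp add: bump_radius_powr)
next
  case False
  then show ?thesis using that(1) K\<^sub>0_outside_bumps by blast
qed

lemma K\<^sub>0_nonpos: "K\<^sub>0 \<eta> l q x \<le> 0"
  by (cases rule: K\<^sub>0_cases[of x]) auto

lemma K\<^sub>0_core:
  assumes "2 \<le> n" "x \<in> ball (bump_center n) (bump_radius q n / 2)"
  shows "- K\<^sub>0 \<eta> l q x = 1 / (bump_radius q n)\<^sup>2 * real n powr (- l)"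
proof -
  have "x \<in> bump n"
    using assms(2) bump_radius_pos[of q n] by (auto simp del: bump_radius_pos)
  from K\<^sub>0_in_bump[OF assms(1) this] \<eta>_inside[OF assms(2)] show ?thesis
    by (simp only: bump_radius_powr)
qed

text \<open>The bump heights are unbounded, but a disc around the origin meets only finitely many
  bumps; the sum of their heights is a convenient bound.\<close>

lemma K\<^sub>0_exp_locally_bounded:
  assumes "continuous_on UNIV u"
  shows "\<exists>B. \<forall>x. norm x \<le> R \<longrightarrow> - K\<^sub>0 \<eta> l q x * exp (2 * u x) \<le> B"
proof -
  have "compact ((\<lambda>x. exp (2 * u x)) ` cball 0 R)"
    by (intro compact_continuous_image continuous_intros continuous_on_subset[OF assms]) auto
  from compact_imp_bounded[OF this]
  obtain E where "\<forall>y\<in>(\<lambda>x. exp (2 * u x)) ` cball 0 R. norm y \<le> E"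
    unfolding bounded_iff by blast
  then have E: "exp (2 * u x) \<le> E" if "norm x \<le> R" for x
    using that by simp
  define k where "k n = 1 / (bump_radius q n)\<^sup>2 * real n powr (- l)" for n
  define S where "S = (\<Sum>n\<le>nat \<lceil>R\<rceil> + 1. k n)"
  have k: "0 \<le> k n" for n by (simp add: k_def)
  then have S: "0 \<le> S" unfolding S_def by (intro sum_nonneg)
  have "- K\<^sub>0 \<eta> l q x \<le> S" if "norm x \<le> R" for x
  proof (cases rule: K\<^sub>0_cases[of x])
    case (2 n)
    from in_bump_norm[OF q 2(1,2)] that have "n \<le> nat \<lceil>R\<rceil> + 1" by linarith
    then have "k n \<le> S" unfolding S_def using k by (intro member_le_sum) auto
    with 2 show ?thesis by (simp add: k_def)
  qed (use S in simp)
  then have "- K\<^sub>0 \<eta> l q x * exp (2 * u x) \<le> S * E" if "norm x \<le> R" for x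
    using that E S by (intro mult_mono) auto
  then show ?thesis by blast
qed

end

text \<open>The \<open>n\<close>-th bump has mass at most of order \<open>n powr (- s)\<close>; as \<open>ln (1 / r\<^sub>n) = n powr q\<close>, the near
  potential there is at most of order \<open>n powr (q - s)\<close>. For the solutions below, \<open>s = l - 2\<alpha>\<close>.\<close>

locale bump_density = planar_solution +
  fixes q s A :: real
  assumes q: "1 < q" and s: "1 < s" and A: "0 \<le> A"
    and mass: "integral\<^sup>L lebesgue f = 2 * pi * \<alpha>"
    and density: "f y \<noteq> 0 \<Longrightarrow> \<exists>n\<ge>2. y \<in> ball (bump_center n) (bump_radius q n) \<and>
      f y \<le> A / (bump_radius q n)\<^sup>2 * real n powr (- s)"
begin

abbreviation bump :: "nat \<Rightarrow> (real ^ 2) set" where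
  "bump n \<equiv> ball (bump_center n) (bump_radius q n)"

lemma support: "f y \<noteq> 0 \<Longrightarrow> 1 \<le> norm y"
  using density[of y] in_bump_norm(2)[OF q] by fastforce

text \<open>A bump has area of order \<open>r\<^sub>n\<^sup>2\<close>, which cancels its height. Up
  to constants the moment is thus bounded by the series of \<open>n powr (- s) * ln (2 * n)\<close>,
  convergent since \<open>1 < s\<close>.\<close>

lemma ln_moment: "integrable lebesgue (\<lambda>y. f y * ln (norm y))"
proof (rule integrableI_bounded)
  define k where "k n = A / (bump_radius q n)\<^sup>2 * real n powr (- s) * ln (2 * real n)" for n
  have [measurable]: "bump n \<in> sets lebesgue" for n by auto
  have term_le: "g n \<le> suminf g" for g :: "nat \<Rightarrow> ennreal" and n
    using sum_le_suminf[of g "{n}"] by simp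
  have "(\<integral>\<^sup>+y. norm (f y * ln (norm y)) \<partial>lebesgue) \<le>
      (\<integral>\<^sup>+y. (\<Sum>n. ennreal (k n) * indicator (bump n) y) \<partial>lebesgue)"
  proof (rule nn_integral_mono)
    fix y
    show "ennreal (norm (f y * ln (norm y))) \<le> (\<Sum>n. ennreal (k n) * indicator (bump n) y)"
    proof (cases "f y = 0")
      case False
      from density[OF this] obtain n where n: "2 \<le> n" "y \<in> bump n"
        "f y \<le> A / (bump_radius q n)\<^sup>2 * real n powr (- s)" by blast
      have "norm y \<le> 2 * real n" using in_bump_norm(1)[OF q n(1,2)] n(1) by linarith
      then have "ln (norm y) \<le> ln (2 * real n)" using support[OF False] by (intro ln_mono) linarith+
      moreover have "ln (norm y) \<ge> 0" using support[OF False] by (rule ln_ge_zero)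
      moreover have "0 \<le> A / (bump_radius q n)\<^sup>2 * real n powr (- s)" using A by simp
      ultimately have "f y * ln (norm y) \<le> k n"
        unfolding k_def using n(3) by (intro mult_mono)
      then have "norm (f y * ln (norm y)) \<le> k n"
        using f_nonneg[of y] \<open>0 \<le> ln (norm y)\<close> by simp
      then have "ennreal (norm (f y * ln (norm y))) \<le> ennreal (k n) * indicator (bump n) y"
        using n(2) by (simp add: ennreal_leI del: mem_ball)
      also have "\<dots> \<le> (\<Sum>n. ennreal (k n) * indicator (bump n) y)"
        by (rule term_le)
      finally show ?thesis .
    qed simp
  qed
  also have "\<dots> = (\<Sum>n. \<integral>\<^sup>+y. ennreal (k n) * indicator (bump n) y \<partial>lebesgue)"
    by (rule nn_integral_suminf) measurable
  also have "\<dots> = (\<Sum>n. ennreal (A * pi * (real n powr (- s) * ln (2 * real n))))"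
  proof (rule suminf_cong)
    fix n
    have "(\<integral>\<^sup>+y. ennreal (k n) * indicator (bump n) y \<partial>lebesgue) =
        ennreal (k n) * ennreal (pi * (bump_radius q n)\<^sup>2)"
      using less_imp_le[OF bump_radius_pos]
      by (subst nn_integral_cmult_indicator) (auto simp: emeasure_completion emeasure_ball
          unit_ball_vol_2)
    also have "\<dots> = ennreal (k n * (pi * (bump_radius q n)\<^sup>2))"
      by (rule ennreal_mult''[symmetric]) simp
    also have "k n * (pi * (bump_radius q n)\<^sup>2) = A * pi * (real n powr (- s) * ln (2 * real n))"
      unfolding k_def using bump_radius_pos[of q n] by (simp add: field_simps del: bump_radius_pos)
    finally show "(\<integral>\<^sup>+y. ennreal (k n) * indicator (bump n) y \<partial>lebesgue) =
        ennreal (A * pi * (real n powr (- s) * ln (2 * real n)))" .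
  qed
  also have "\<dots> < \<infinity>"
  proof -
    have "summable (\<lambda>n. real n powr (- s) * ln (2 * real n))"
    \<comment> \<open>The exponent \<open>(1 + s) / 2\<close> lies strictly between 1 and
      \<open>s\<close>: still summable, with room to absorb the logarithm.\<close>
    proof (rule summable_comparison_test_bigo)
      show "summable (\<lambda>n. norm (real n powr (- (1 + s) / 2)))"
        using s by (simp add: summable_real_powr_iff)
      show "(\<lambda>n. real n powr (- s) * ln (2 * real n)) \<in> O(\<lambda>n. real n powr (- (1 + s) / 2))"
        using s by real_asymp
    qed
    then have "summable (\<lambda>n. A * pi * (real n powr (- s) * ln (2 * real n)))"
      by (rule summable_mult)
    moreover have "0 \<le> A * pi * (real n powr (- s) * ln (2 * real n))" for n
      using A by (cases "n = 0") auto
    ultimately show ?thesis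
      by (simp add: suminf_ennreal2 flip: less_top)
  qed
  finally show "(\<integral>\<^sup>+y. norm (f y * ln (norm y)) \<partial>lebesgue) < \<infinity>" .
  have [measurable]: "(\<lambda>y::real ^ 2. ln (norm y)) \<in> borel_measurable lebesgue"
    by (intro measurable_completion) measurable
  show "(\<lambda>y. f y * ln (norm y)) \<in> borel_measurable lebesgue" by measurable
qed

section \<open>Two-sided bounds for the near potential\<close>

text \<open>At most four bumps come within distance 1 of \<open>x\<close>, each contributing at most
  \<open>3 * A * pi * (norm x - 2) powr (q - s)\<close>; dividing by \<open>2 * pi\<close> gives the
  constant 6. The base \<open>norm x - 2\<close> is a lower bound for the relevant indices, usable
  because the exponent is not positive.\<close>

lemma near_potential_le:
  assumes qs: "q \<le> s" and x: "norm x \<ge> 3"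
  shows "near_potential x \<le> 6 * A * (norm x - 2) powr (q - s)"
proof -
  define N where "N = {n::nat. 2 \<le> n \<and> \<bar>real n - norm x\<bar> < 2}"
  define k where "k n = A / (bump_radius q n)\<^sup>2 * real n powr (- s)" for n
  define w where "w n y = k n * (real n powr q * indicator (bump n) y +
      max 0 (ln (bump_radius q n / norm (y - x))))" for n y
  have k: "0 \<le> k n" for n using A by (simp add: k_def)
  \<comment> \<open>Integers at distance less than 2 from a real number lie between its floor minus
    1 and its floor plus 2.\<close>
  have N_sub: "N \<subseteq> {nat \<lfloor>norm x\<rfloor> - 1..nat \<lfloor>norm x\<rfloor> + 2}"
    unfolding N_def using x by (auto simp: abs_less_iff) linarith+
  then have fin: "finite N" by (rule finite_subset) simp
  have "card N \<le> card {nat \<lfloor>norm x\<rfloor> - 1..nat \<lfloor>norm x\<rfloor> + 2}" using N_sub by (intro card_mono) auto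
  also have "\<dots> \<le> 4" using x by simp
  finally have card: "card N \<le> 4" .
  have w_nonneg: "0 \<le> w n y" for n y using k by (simp add: w_def)
  have ind: "integrable lebesgue (indicator (bump n) :: _ \<Rightarrow> real)" for n
    using emeasure_lborel_ball_finite[of "bump_center n" "bump_radius q n"]
    by (intro integrable_real_indicator) (simp_all add: emeasure_completion)
  have w_int: "integrable lebesgue (w n)" for n
    unfolding w_def by (intro integrable_mult_right Bochner_Integration.integrable_add ind
        integrable_ln_pos) simp
  have "(LINT y|lebesgue. f y * max 0 (ln (1 / norm (y - x)))) \<le> (LINT y|lebesgue. (\<Sum>n\<in>N. w n y))"
  proof (rule integral_mono)
    show "integrable lebesgue (\<lambda>y. f y * max 0 (ln (1 / norm (y - x))))"
      by (rule f_ln_pos_integrable) simp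
    show "integrable lebesgue (\<lambda>y. \<Sum>n\<in>N. w n y)" using w_int by auto
    fix y
    show "f y * max 0 (ln (1 / norm (y - x))) \<le> (\<Sum>n\<in>N. w n y)"
    proof (cases "f y = 0 \<or> norm (y - x) \<ge> 1 \<or> y = x")
      case True
      then have zero: "f y * max 0 (ln (1 / norm (y - x))) = 0"
        by (auto simp: ln_div max_def)
      show ?thesis unfolding zero using w_nonneg by (rule sum_nonneg)
    next
      case False
      from density[of y] False obtain n where n: "2 \<le> n" "y \<in> bump n" "f y \<le> k n"
        unfolding k_def by blast
      have "n \<in> N"
        using in_bump_norm[OF q n(1,2)] n(1) False norm_triangle_sub[of x y]
            norm_triangle_sub[of y x]
        by (simp add: N_def norm_minus_commute abs_less_iff)
      \<comment> \<open>Rescaling by the bump radius separates the constant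
        \<open>ln (1 / r\<^sub>n)\<close> from a remainder whose integral is at most
        \<open>2 * pi * r\<^sub>n\<^sup>2\<close>, comparable to the area of the bump.\<close>
      have "ln (1 / norm (y - x)) = real n powr q + ln (bump_radius q n / norm (y - x))"
        using False by (simp add: bump_radius_def ln_div)
      then have "max 0 (ln (1 / norm (y - x))) \<le>
          real n powr q * indicator (bump n) y + max 0 (ln (bump_radius q n / norm (y - x)))"
        using n(2) by (simp add: max_def del: mem_ball)
      then have "f y * max 0 (ln (1 / norm (y - x))) \<le> w n y"
        unfolding w_def using n(3) f_nonneg[of y] k by (intro mult_mono) auto
      also have "\<dots> \<le> (\<Sum>n\<in>N. w n y)"
        using \<open>n \<in> N\<close> fin w_nonneg by (intro member_le_sum) auto
      finally show ?thesis .
    qed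
  qed
  also have "\<dots> = (\<Sum>n\<in>N. integral\<^sup>L lebesgue (w n))"
    using w_int by (intro Bochner_Integration.integral_sum) auto
  also have "\<dots> \<le> (\<Sum>n\<in>N. 3 * A * pi * (norm x - 2) powr (q - s))"
  proof (rule sum_mono)
    fix n assume "n \<in> N"
    then have n: "2 \<le> n" "norm x - 2 \<le> real n" by (auto simp: N_def)
    let ?r = "bump_radius q n"
    have "integral\<^sup>L lebesgue (w n) =
        k n * (real n powr q * (pi * ?r\<^sup>2) + (LINT y|lebesgue. max 0 (ln (?r / norm (y - x)))))"
      using ind[of n] integrable_ln_pos[of ?r x] less_imp_le[OF bump_radius_pos[of q n]]
      by (simp add: w_def[abs_def] content_ball unit_ball_vol_2)
    also have "\<dots> \<le> k n * (real n powr q * (pi * ?r\<^sup>2) + 2 * pi * ?r\<^sup>2)"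
      using k integral_ln_pos_le[of ?r x] by (intro mult_left_mono add_left_mono) auto
    also have "\<dots> = A * pi * (real n powr (- s) * (real n powr q + 2))"
      unfolding k_def using bump_radius_pos[of q n] by (simp add: field_simps del: bump_radius_pos)
    also have "\<dots> \<le> A * pi * (real n powr (- s) * (3 * real n powr q))"
      using A n(1) q ge_one_powr_ge_zero[of "real n" q] by (intro mult_left_mono) auto
    also have "\<dots> = 3 * A * pi * real n powr (q - s)"
      by (simp add: powr_diff powr_minus field_simps)
    also have "\<dots> \<le> 3 * A * pi * (norm x - 2) powr (q - s)"
      using A x n qs by (intro mult_left_mono powr_mono2') auto
    finally show "integral\<^sup>L lebesgue (w n) \<le> 3 * A * pi * (norm x - 2) powr (q - s)" .
  qed
  also have "\<dots> = real (card N) * (3 * A * pi * (norm x - 2) powr (q - s))" by simp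
  also have "\<dots> \<le> 4 * (3 * A * pi * (norm x - 2) powr (q - s))"
    using card A by (intro mult_right_mono) auto
  finally have "(LINT y|lebesgue. f y * max 0 (ln (1 / norm (y - x)))) / (2 * pi) \<le>
      4 * (3 * A * pi * (norm x - 2) powr (q - s)) / (2 * pi)"
    by (intro divide_right_mono) auto
  then show ?thesis by (simp add: near_potential_def)
qed

text \<open>All bumps sit around the positive axis, at distance more than 1 from these points, where
  the truncated logarithm vanishes.\<close>

lemma near_potential_left: "near_potential (- bump_center (Suc n)) = 0"
proof -
  have "(\<lambda>y. f y * max 0 (ln (1 / norm (y + bump_center (Suc n))))) = (\<lambda>_. 0)"
  proof
    fix y
    show "f y * max 0 (ln (1 / norm (y + bump_center (Suc n)))) = 0"
    proof (cases "f y = 0")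
      case False
      from density[OF this] obtain m where m: "2 \<le> m" "y \<in> bump m" by blast
      have "norm (bump_center m - y) < 1 / 2"
        using m bump_radius_less_half[OF q m(1)] by (simp add: dist_norm)
      moreover have "bump_center m + bump_center (Suc n) = bump_center (m + Suc n)"
        by (simp add: bump_center_eq scaleR_left_distrib)
      then have "real (m + Suc n) \<le> norm (bump_center m - y) + norm (y + bump_center (Suc n))"
        using norm_triangle_ineq[of "bump_center m - y" "y + bump_center (Suc n)"]
        by (metis (no_types, opaque_lifting) add.assoc diff_add_cancel norm_bump_center)
      ultimately have "1 \<le> norm (y + bump_center (Suc n))" using m(1) by simp
      then show ?thesis by (subst ln_div) auto
    qed simp
  qed
  then show ?thesis
    by (simp only: near_potential_def diff_minus_eq_add Bochner_Integration.integral_zero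
        mult_zero_right)
qed

text \<open>Only the half-radius core is kept, where the profile is 1. Its area is a quarter of
  \<open>pi * r\<^sub>n\<^sup>2\<close> and the logarithm is at least \<open>n powr q\<close> on it;
  with the prefactor \<open>1 / (2 * pi)\<close> this yields the factor 1/8.\<close>

lemma near_potential_center_ge:
  assumes "2 \<le> n" "0 \<le> c"
    and core: "\<And>y. y \<in> ball (bump_center n) (bump_radius q n / 2) \<Longrightarrow>
      c / (bump_radius q n)\<^sup>2 * real n powr (- s) \<le> f y"
  shows "c / 8 * real n powr (q - s) \<le> near_potential (bump_center n)"
proof -
  let ?r = "bump_radius q n" and ?a = "bump_center n"
  let ?B = "ball ?a (?r / 2)"
  let ?w = "c / ?r\<^sup>2 * real n powr (- s) * real n powr q"
  have "(LINT y|lebesgue. ?w * indicator ?B y) \<le>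
      (LINT y|lebesgue. f y * max 0 (ln (1 / norm (y - ?a))))"
  proof (rule integral_mono_AE)
    show "integrable lebesgue (\<lambda>y. ?w * indicator ?B y)"
      using emeasure_lborel_ball_finite[of ?a "?r / 2"]
      by (intro integrable_mult_right integrable_real_indicator) (simp_all add: emeasure_completion)
    show "integrable lebesgue (\<lambda>y. f y * max 0 (ln (1 / norm (y - ?a))))"
      by (rule f_ln_pos_integrable) simp
    show "AE y in lebesgue. ?w * indicator ?B y \<le> f y * max 0 (ln (1 / norm (y - ?a)))"
      using AE_lebesgue_neq[of ?a]
    proof eventually_elim
      case (elim y)
      show ?case
      proof (cases "y \<in> ?B")
        case True
        then have "norm (y - ?a) \<le> ?r"
          using bump_radius_pos[of q n] by (simp add: dist_norm norm_minus_commute del: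
              bump_radius_pos)
        then have "ln (norm (y - ?a)) \<le> - (real n powr q)"
          using elim ln_mono[of "norm (y - ?a)" ?r] by (simp add: bump_radius_def)
        then have "real n powr q \<le> max 0 (ln (1 / norm (y - ?a)))" using elim by (simp add: ln_div)
        then have "?w \<le> f y * max 0 (ln (1 / norm (y - ?a)))"
          using core[OF True] f_nonneg[of y] by (intro mult_mono) auto
        with True show ?thesis by simp
      qed (use f_nonneg in simp)
    qed
  qed
  also have "(LINT y|lebesgue. ?w * indicator ?B y) = ?w * (pi * (?r / 2)\<^sup>2)"
    using less_imp_le[OF bump_radius_pos[of q n]]
    by (simp add: content_ball unit_ball_vol_2)
  also have "?w * (pi * (?r / 2)\<^sup>2) = c / 8 * real n powr (q - s) * (2 * pi)"
    using bump_radius_pos[of q n] assms(1)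
    by (simp add: powr_diff powr_minus field_simps power_divide del: bump_radius_pos)
  finally have "c / 8 * real n powr (q - s) * (2 * pi) / (2 * pi) \<le>
      (LINT y|lebesgue. f y * max 0 (ln (1 / norm (y - ?a)))) / (2 * pi)"
    by (intro divide_right_mono) auto
  then show ?thesis by (simp add: near_potential_def)
qed

section \<open>The three regimes of the exponent\<close>

lemma limit_with_near_potential:
  obtains C where "((\<lambda>x. u x - \<alpha> * ln (norm x) + near_potential x) \<longlongrightarrow> C) at_infinity"
  using solution_asymptotics[OF mass support ln_moment] by blast

lemma converges_if_exponent_less:
  assumes "q < s"
  shows "\<exists>C. ((\<lambda>x. u x - \<alpha> * ln (norm x)) \<longlongrightarrow> C) at_infinity"
proof -
  obtain C where C: "((\<lambda>x. u x - \<alpha> * ln (norm x) + near_potential x) \<longlongrightarrow> C) at_infinity"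
    by (rule limit_with_near_potential)
  have "((\<lambda>t. 6 * A * (t - 2) powr (q - s)) \<longlongrightarrow> 0) at_top"
    using assms by real_asymp
  then have "((\<lambda>x. 6 * A * (norm x - 2) powr (q - s)) \<longlongrightarrow> 0) (at_infinity :: (real ^ 2) filter)"
    by (rule filterlim_compose) (rule filterlim_norm_at_top)
  then have "(near_potential \<longlongrightarrow> 0) at_infinity"
  proof (rule Lim_null_comparison[rotated])
    show "\<forall>\<^sub>F x in at_infinity. norm (near_potential x) \<le> 6 * A * (norm x - 2) powr (q - s)"
      unfolding eventually_at_infinity using near_potential_le near_potential_nonneg assms
      by (intro exI[of _ 3]) auto
  qed
  from tendsto_diff[OF C this] show ?thesis by auto
qed

lemma bounded_if_exponent_eq:
  assumes "q = s"
  shows "(\<lambda>x. u x - \<alpha> * ln (norm x)) \<in> O[at_infinity](\<lambda>_. 1)"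
proof -
  obtain C where C: "((\<lambda>x. u x - \<alpha> * ln (norm x) + near_potential x) \<longlongrightarrow> C) at_infinity"
    by (rule limit_with_near_potential)
  from tendstoD[OF this, of 1]
  have "\<forall>\<^sub>F x in at_infinity. \<bar>u x - \<alpha> * ln (norm x) + near_potential x - C\<bar> < 1"
    by (simp add: dist_real_def)
  moreover have "\<forall>\<^sub>F x in at_infinity. norm x \<ge> 3" for x :: "real ^ 2"
    unfolding eventually_at_infinity by blast
  then have "\<forall>\<^sub>F x in at_infinity. near_potential x \<le> 6 * A"
    unfolding eventually_at_infinity
  proof (intro exI[of _ 3] allI impI)
    fix x :: "real ^ 2" assume "3 \<le> norm x"
    with near_potential_le[of x] assms show "near_potential x \<le> 6 * A" by simp
  qed
  ultimately have "\<forall>\<^sub>F x in at_infinity. norm (u x - \<alpha> * ln (norm x)) \<le>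
      (\<bar>C\<bar> + 1 + 6 * A) * norm (1::real)"
  proof eventually_elim
    case (elim x)
    then have "\<bar>u x - \<alpha> * ln (norm x)\<bar> \<le> \<bar>C\<bar> + 1 + 6 * A"
      using near_potential_nonneg[of x] by linarith
    then show ?case by simp
  qed
  then show ?thesis by (rule bigoI)
qed

text \<open>A limit of \<open>u x - \<alpha> * ln (norm x)\<close> would force the near potential to
  converge as well. Along the negative axis its limit would be 0, along the bump centres at least
  \<open>c / 8\<close>.\<close>

lemma not_convergent_if_exponent_eq:
  assumes "q = s" and c: "0 < c"
    and core: "\<And>n y. n0 \<le> n \<Longrightarrow> y \<in> ball (bump_center n) (bump_radius q n / 2) \<Longrightarrow>
      c / (bump_radius q n)\<^sup>2 * real n powr (- s) \<le> f y"
  shows "\<not> ((\<lambda>x. u x - \<alpha> * ln (norm x)) \<longlongrightarrow> d) at_infinity"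
proof
  assume d: "((\<lambda>x. u x - \<alpha> * ln (norm x)) \<longlongrightarrow> d) at_infinity"
  obtain C where "((\<lambda>x. u x - \<alpha> * ln (norm x) + near_potential x) \<longlongrightarrow> C) at_infinity"
    by (rule limit_with_near_potential)
  from tendsto_diff[OF this d] have lim: "(near_potential \<longlongrightarrow> C - d) at_infinity" by simp
  have "filterlim (\<lambda>n. - bump_center (Suc n)) at_infinity sequentially"
    unfolding filterlim_at_infinity_conv_norm_at_top norm_minus_cancel norm_bump_center by real_asymp
  from filterlim_compose[OF lim this] have "C - d = 0"
    by (simp add: near_potential_left LIMSEQ_const_iff)
  moreover have "c / 8 \<le> C - d"
  proof (rule tendsto_lowerbound)
    have "filterlim bump_center at_infinity sequentially"
      unfolding filterlim_at_infinity_conv_norm_at_top norm_bump_center by real_asymp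
    from filterlim_compose[OF lim this] show "(\<lambda>n. near_potential (bump_center n)) \<longlonglongrightarrow> C - d" .
    show "\<forall>\<^sub>F n in sequentially. c / 8 \<le> near_potential (bump_center n)"
      using eventually_ge_at_top[of "max 2 n0"]
    proof eventually_elim
      case (elim n)
      with near_potential_center_ge[of n c] core[of n] c \<open>q = s\<close> show ?case by simp
    qed
  qed simp
  ultimately show False using c by simp
qed

text \<open>Boundedness would make the near potential bounded near infinity, whereas at the bump
  centres it grows like a positive power of \<open>n\<close>.\<close>

lemma unbounded_if_exponent_greater:
  assumes "s < q" and c: "0 < c"
    and core: "\<And>n y. n0 \<le> n \<Longrightarrow> y \<in> ball (bump_center n) (bump_radius q n / 2) \<Longrightarrow>
      c / (bump_radius q n)\<^sup>2 * real n powr (- s) \<le> f y"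
  shows "(\<lambda>x. u x - \<alpha> * ln (norm x)) \<notin> O[at_infinity](\<lambda>_. 1)"
proof
  assume "(\<lambda>x. u x - \<alpha> * ln (norm x)) \<in> O[at_infinity](\<lambda>_. 1)"
  then obtain M where M: "\<forall>\<^sub>F x in at_infinity. norm (u x - \<alpha> * ln (norm x)) \<le> M * norm (1::real)"
    by (elim landau_o.bigE)
  obtain C where "((\<lambda>x. u x - \<alpha> * ln (norm x) + near_potential x) \<longlongrightarrow> C) at_infinity"
    by (rule limit_with_near_potential)
  from tendstoD[OF this, of 1]
  have "\<forall>\<^sub>F x in at_infinity. \<bar>u x - \<alpha> * ln (norm x) + near_potential x - C\<bar> < 1"
    by (simp add: dist_real_def)
  with M have bound: "\<forall>\<^sub>F x in at_infinity. near_potential x \<le> M + \<bar>C\<bar> + 1"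
  proof eventually_elim
    case (elim x)
    then have "\<bar>u x - \<alpha> * ln (norm x)\<bar> \<le> M" by simp
    with elim(2) show ?case by linarith
  qed
  have "filterlim bump_center at_infinity sequentially"
    unfolding filterlim_at_infinity_conv_norm_at_top norm_bump_center by real_asymp
  from eventually_compose_filterlim[OF bound this]
  have "\<forall>\<^sub>F n in sequentially. near_potential (bump_center n) \<le> M + \<bar>C\<bar> + 1" .
  moreover have "filterlim (\<lambda>n. c / 8 * real n powr (q - s)) at_top sequentially"
    using assms(1) c by real_asymp
  then have "\<forall>\<^sub>F n in sequentially. M + \<bar>C\<bar> + 1 < c / 8 * real n powr (q - s)"
    unfolding filterlim_at_top_dense by (rule spec)
  ultimately have "\<forall>\<^sub>F n in sequentially. False"
    using eventually_ge_at_top[of "max 2 n0"]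
  proof eventually_elim
    case (elim n)
    with near_potential_center_ge[of n c] core[of n] c show ?case by simp
  qed
  then show False by simp
qed

end

section \<open>Cheng-Lin solutions as bump densities\<close>

lemma plane_cutoff_profile:
  assumes "C_infinity \<eta>"
    and ge: "\<And>x. indicator (ball 0 (1/2)) x \<le> \<eta> x" and le: "\<And>x. \<eta> x \<le> indicator (ball 0 1) x"
  shows "plane_cutoff (\<lambda>t. \<eta> (t *\<^sub>R (axis 1 1 :: real ^ 2)))"
proof
  have norm: "norm (t *\<^sub>R (axis 1 1 :: real ^ 2)) = \<bar>t\<bar>" for t by simp
  show "C_k k (\<lambda>t. \<eta> (t *\<^sub>R (axis 1 1 :: real ^ 2)))" for k
    using assms(1) by (intro C_k_along_line) (simp add: C_infinity_def)
  show nonneg: "0 \<le> \<eta> (s *\<^sub>R axis 1 1)" for s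
    by (rule order_trans[OF _ ge]) simp
  show le_one: "\<eta> (s *\<^sub>R axis 1 1) \<le> 1" for s
    by (rule order_trans[OF le]) (simp add: indicator_def)
  show "\<eta> (s *\<^sub>R axis 1 1) = 1" if "\<bar>s\<bar> < 1/2" for s
    using ge[of "s *\<^sub>R axis 1 1"] le_one[of s] that norm[of s] by (simp add: indicator_def)
  show "\<eta> (s *\<^sub>R axis 1 1) = 0" if "1 \<le> s" for s
    using le[of "s *\<^sub>R axis 1 1"] nonneg[of s] that norm[of s] by (simp add: indicator_def)
qed

lemma planar_solution_of_cheng_lin:
  assumes "bump_profile \<eta> q" and "C_infinity \<eta>"
    and "cheng_lin_solution (K\<^sub>0 \<eta> l q) \<alpha> u"
  obtains G where "planar_solution (\<lambda>t. \<eta> (t *\<^sub>R axis 1 1)) u (\<lambda>x. -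
      K\<^sub>0 \<eta> l q x * exp (2 * u x)) \<alpha> G"
    and "integral\<^sup>L lebesgue (\<lambda>x. - K\<^sub>0 \<eta> l q x * exp (2 * u x)) = 2 * pi * \<alpha>"
proof -
  interpret bump_profile \<eta> l q by fact
  let ?f = "\<lambda>x. - K\<^sub>0 \<eta> l q x * exp (2 * u x)"
  from assms(3) obtain G where
    sol: "liouville_solution (K\<^sub>0 \<eta> l q) u"
    and int: "has_bochner_integral lebesgue (\<lambda>x. K\<^sub>0 \<eta> l q x * exp (2 * u x)) (- 2 * \<alpha> * pi)"
    and G: "weak_gradient_on (- cball 0 1) (\<lambda>x. u x - \<alpha> * ln (norm x)) G"
      "(\<lambda>x. (norm (G x))\<^sup>2) absolutely_integrable_on (- ball 0 1)"
    unfolding cheng_lin_solution_def by blast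
  interpret plane_cutoff "\<lambda>t. \<eta> (t *\<^sub>R axis 1 1)"
    by (rule plane_cutoff_profile[OF assms(2) \<eta>_ge \<eta>_le])
  have cont: "continuous_on UNIV u" using sol by (simp add: liouville_solution_def)
  have f: "has_bochner_integral lebesgue ?f (2 * pi * \<alpha>)"
    using has_bochner_integral_minus[OF int] by (simp add: mult_ac)
  show ?thesis
  proof (rule that)
    show "planar_solution (\<lambda>t. \<eta> (t *\<^sub>R axis 1 1)) u ?f \<alpha> G"
    proof
      show "0 \<le> ?f x" for x using K\<^sub>0_nonpos[of x] by (simp add: mult_nonpos_nonneg)
      show "integrable lebesgue ?f" using f by (simp only: has_bochner_integral_iff)
      show "\<exists>B. \<forall>x. norm x \<le> R \<longrightarrow> ?f x \<le> B" for R
        by (rule K\<^sub>0_exp_locally_bounded[OF cont])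
      show "(LINT x|lebesgue. u x * laplacian \<phi> x - ?f x * \<phi> x) = 0" if "test_function_on UNIV \<phi>"
          for \<phi>
        using sol that by (simp add: liouville_solution_def)
    qed (use cont G in auto)
    show "integral\<^sup>L lebesgue ?f = 2 * pi * \<alpha>"
      using f by (simp only: has_bochner_integral_iff)
  qed
qed

text \<open>On the \<open>n\<close>-th bump the a priori bound gives \<open>exp (2 * u)\<close> at
  most \<open>A * n powr (2 * \<alpha>)\<close>, which shifts the decay exponent of the coefficient
  from \<open>l\<close> to \<open>l - 2 * \<alpha>\<close>.\<close>

lemma bump_density_of_cheng_lin:
  assumes "bump_profile \<eta> q" and "C_infinity \<eta>"
    and "cheng_lin_solution (K\<^sub>0 \<eta> l q) \<alpha> u" and \<alpha>: "0 < \<alpha>" "1 < l - 2 * \<alpha>"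
  obtains G A where "bump_density (\<lambda>t. \<eta> (t *\<^sub>R axis 1 1)) u (\<lambda>x. -
      K\<^sub>0 \<eta> l q x * exp (2 * u x)) \<alpha> G q (l - 2 * \<alpha>) A"
proof -
  interpret bump_profile \<eta> l q by fact
  let ?f = "\<lambda>x. - K\<^sub>0 \<eta> l q x * exp (2 * u x)"
  obtain G where "planar_solution (\<lambda>t. \<eta> (t *\<^sub>R axis 1 1)) u ?f \<alpha> G" and mass:
      "integral\<^sup>L lebesgue ?f = 2 * pi * \<alpha>"
    by (rule planar_solution_of_cheng_lin[OF assms(1-3)])
  then interpret planar_solution "\<lambda>t. \<eta> (t *\<^sub>R axis 1 1)" u ?f \<alpha> G by simp
  have "1 \<le> norm y" if "?f y \<noteq> 0" for y
  proof (cases rule: K\<^sub>0_cases[of y])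
    case (2 n)
    with in_bump_norm(2)[OF q 2(1,2)] show ?thesis by simp
  qed (use that in simp)
  note upper = solution_upper_bound[OF mass this]
  \<comment> \<open>The power of 2 comes from \<open>1 + norm y \<le> 2 * n\<close> on the
    \<open>n\<close>-th bump.\<close>
  define A where "A = exp (2 * u 0) * 2 powr (2 * \<alpha>)"
  show ?thesis
  proof (rule that)
    show "bump_density (\<lambda>t. \<eta> (t *\<^sub>R axis 1 1)) u ?f \<alpha> G q (l - 2 * \<alpha>) A"
    proof
      fix y assume y: "?f y \<noteq> 0"
      show "\<exists>n\<ge>2. y \<in> ball (bump_center n) (bump_radius q n) \<and>
        ?f y \<le> A / (bump_radius q n)\<^sup>2 * real n powr (- (l - 2 * \<alpha>))"
      proof (cases rule: K\<^sub>0_cases[of y])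
        case (2 n)
        have "ln (1 + norm y) \<le> ln (2 * real n)"
          using in_bump_norm(1)[OF q 2(1,2)] 2(1) norm_ge_zero[of y] by (intro ln_mono) linarith+
        then have "u y \<le> u 0 + \<alpha> * ln (2 * real n)"
          using upper[of y] mult_left_mono[of "ln (1 + norm y)" "ln (2 * real n)" \<alpha>] \<alpha> by linarith
        then have "exp (2 * u y) \<le> exp (2 * u 0 + 2 * \<alpha> * ln (2 * real n))" by simp
        also have "\<dots> = A * real n powr (2 * \<alpha>)"
          using 2(1) by (simp add: A_def exp_add powr_def ln_mult distrib_left)
        finally have "?f y \<le> (1 / (bump_radius q n)\<^sup>2 * real n powr (- l)) *
            (A * real n powr (2 * \<alpha>))"
          using 2(4) K\<^sub>0_nonpos[of y] by (intro mult_mono) auto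
        also have "\<dots> = A / (bump_radius q n)\<^sup>2 * real n powr (- (l - 2 * \<alpha>))"
          by (simp add: powr_diff powr_minus field_simps)
        finally show ?thesis using 2(1,2) by blast
      qed (use y in simp)
    qed (use q \<alpha> mass in \<open>auto simp: A_def\<close>)
  qed
qed

text \<open>On the core the coefficient is known exactly, and the assumed bound gives
  \<open>u\<close> at least \<open>\<alpha> * ln (n / 2) - M\<close>. The lower estimate for
  \<open>f\<close> thus has the same power of \<open>n\<close> as the upper one.\<close>

lemma (in bump_profile) density_core_lower_bound:
  assumes "0 \<le> \<alpha>" and "(\<lambda>x. u x - \<alpha> * ln (norm x)) \<in> O[at_infinity](\<lambda>_. 1)"
  obtains c n0 where "0 < c" and "\<And>n y. n0 \<le> n \<Longrightarrow> y \<in> ball (bump_center n) (bump_radius q n / 2) \<Longrightarrow>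
      c / (bump_radius q n)\<^sup>2 * real n powr (- (l - 2 * \<alpha>)) \<le> - K\<^sub>0 \<eta> l q y * exp (2 * u y)"
proof -
  from assms(2) obtain M where "\<forall>\<^sub>F x in at_infinity. norm (u x - \<alpha> * ln (norm x)) \<le>
      M * norm (1::real)"
    by (elim landau_o.bigE)
  then obtain R where R: "\<And>x. R \<le> norm x \<Longrightarrow> \<bar>u x - \<alpha> * ln (norm x)\<bar> \<le> M"
    unfolding eventually_at_infinity by auto
  define c where "c = exp (- 2 * M) * (1 / 2) powr (2 * \<alpha>)"
  show thesis
  proof (rule that)
    show "0 < c" by (simp add: c_def)
    \<comment> \<open>The margin of 2 ensures both that bump \<open>n\<close> occurs in the sum and
      that all its points have norm at least \<open>R\<close>.\<close>
    fix n y assume "nat \<lceil>R\<rceil> + 2 \<le> n" and y: "y \<in> ball (bump_center n) (bump_radius q n / 2)"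
    then have n: "2 \<le> n" "R \<le> real n - 1 / 2" by linarith+
    have "y \<in> bump n" using y bump_radius_pos[of q n] by (auto simp del: bump_radius_pos)
    from in_bump_norm(2)[OF q n(1) this] n have norm_y: "R \<le> norm y" "real n / 2 \<le> norm y"
      by linarith+
    have "ln (real n / 2) \<le> ln (norm y)" using norm_y(2) n(1) by (intro ln_mono) auto
    then have "\<alpha> * ln (real n / 2) - M \<le> u y"
      using R[OF norm_y(1)] mult_left_mono[of "ln (real n / 2)" "ln (norm y)" \<alpha>] assms(1) by linarith
    then have "exp (- 2 * M + 2 * \<alpha> * ln (real n / 2)) \<le> exp (2 * u y)" by simp
    moreover have "exp (- 2 * M + 2 * \<alpha> * ln (real n / 2)) = c * real n powr (2 * \<alpha>)"
      using n(1) by (simp add: c_def powr_def ln_div distrib_left right_diff_distrib flip: exp_add)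
    ultimately have "c * real n powr (2 * \<alpha>) \<le> exp (2 * u y)" by (simp only:)
    then have "1 / (bump_radius q n)\<^sup>2 * real n powr (- l) * (c * real n powr (2 * \<alpha>)) \<le>
        - K\<^sub>0 \<eta> l q y * exp (2 * u y)"
      unfolding K\<^sub>0_core[OF n(1) y] by (intro mult_left_mono) auto
    moreover have "1 / (bump_radius q n)\<^sup>2 * real n powr (- l) * (c * real n powr (2 * \<alpha>)) =
        c / (bump_radius q n)\<^sup>2 * real n powr (- (l - 2 * \<alpha>))"
      by (simp add: powr_diff powr_minus field_simps)
    ultimately show "c / (bump_radius q n)\<^sup>2 * real n powr (- (l - 2 * \<alpha>)) \<le>
        - K\<^sub>0 \<eta> l q y * exp (2 * u y)"
      by (simp only:)
  qed
qed

text \<open>With \<open>s = l - 2 * \<alpha>\<close>, comparing \<open>\<alpha>\<close> with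
  \<open>(l - q) / 2\<close> is comparing \<open>q\<close> with \<open>s\<close>, and
  \<open>\<alpha> < (l - 1) / 2\<close> is \<open>1 < s\<close>. The lower density bound presupposes
  boundedness: at the critical value this has just been proved, above it boundedness is assumed and
  then contradicted.\<close>

theorem theorem1p2:
  fixes l q :: real and \<eta>\<^sub>0 :: "real ^ 2 \<Rightarrow> real"
  assumes "1 < q" and "q < l"
    and "C_infinity \<eta>\<^sub>0" and "radial \<eta>\<^sub>0"
    and "\<And>x. indicator (ball 0 (1/2)) x \<le> \<eta>\<^sub>0 x"
    and "\<And>x. \<eta>\<^sub>0 x \<le> indicator (ball 0 1) x"
  shows "(\<forall>\<alpha> u. 0 < \<alpha> \<and> \<alpha> < (l - q) / 2 \<and> cheng_lin_solution (K\<^sub>0 \<eta>\<^sub>0 l q) \<alpha> u \<longrightarrow>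
            (\<exists>c. (\<lambda>x. u x - (\<alpha> * ln (norm x) + c)) \<in> o[at_infinity](\<lambda>_. 1)))
       \<and> (\<forall>\<alpha> u. \<alpha> = (l - q) / 2 \<and> cheng_lin_solution (K\<^sub>0 \<eta>\<^sub>0 l q) \<alpha> u \<longrightarrow>
            (\<lambda>x. u x - \<alpha> * ln (norm x)) \<in> O[at_infinity](\<lambda>_. 1)
            \<and> \<not> (\<exists>c. ((\<lambda>x. u x - \<alpha> * ln (norm x)) \<longlongrightarrow> c) at_infinity))
       \<and> (\<forall>\<alpha> u. (l - q) / 2 < \<alpha> \<and> \<alpha> < (l - 1) / 2 \<and>
                cheng_lin_solution (K\<^sub>0 \<eta>\<^sub>0 l q) \<alpha> u \<longrightarrow>
            (\<lambda>x. u x - \<alpha> * ln (norm x)) \<notin> O[at_infinity](\<lambda>_. 1))"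
proof (intro conjI allI impI; elim conjE)
  note profile = bump_profile.intro[OF assms(1,5,6)]
  interpret bump_profile \<eta>\<^sub>0 l q by (rule profile)
  {
    fix \<alpha> u
    assume \<alpha>: "0 < \<alpha>" "\<alpha> < (l - q) / 2" and u: "cheng_lin_solution (K\<^sub>0 \<eta>\<^sub>0 l q) \<alpha> u"
    obtain G A where "bump_density (\<lambda>t. \<eta>\<^sub>0 (t *\<^sub>R axis 1 1)) u (\<lambda>x. -
        K\<^sub>0 \<eta>\<^sub>0 l q x * exp (2 * u x)) \<alpha> G q (l - 2 * \<alpha>) A"
      by (rule bump_density_of_cheng_lin[OF profile assms(3) u]) (use \<alpha> assms(1) in \<open>auto simp:
          field_simps\<close>)
    from bump_density.converges_if_exponent_less[OF this] \<alpha>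
    obtain c where "((\<lambda>x. u x - \<alpha> * ln (norm x)) \<longlongrightarrow> c) at_infinity" by (auto simp: field_simps)
    from tendsto_diff[OF this tendsto_const[of c]]
    show "\<exists>c. (\<lambda>x. u x - (\<alpha> * ln (norm x) + c)) \<in> o[at_infinity](\<lambda>_. 1)"
      by (intro exI[of _ c]) (auto intro!: smalloI_tendsto simp: diff_diff_eq)
  next
    fix \<alpha> u
    assume \<alpha>: "\<alpha> = (l - q) / 2" and u: "cheng_lin_solution (K\<^sub>0 \<eta>\<^sub>0 l q) \<alpha> u"
    have pos: "0 < \<alpha>" "1 < l - 2 * \<alpha>" "q = l - 2 * \<alpha>" using \<alpha> assms(1,2) by (auto simp: field_simps)
    obtain G A where d: "bump_density (\<lambda>t. \<eta>\<^sub>0 (t *\<^sub>R axis 1 1)) u (\<lambda>x. -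
        K\<^sub>0 \<eta>\<^sub>0 l q x * exp (2 * u x)) \<alpha> G q (l - 2 * \<alpha>) A"
      by (rule bump_density_of_cheng_lin[OF profile assms(3) u pos(1,2)])
    show bigo: "(\<lambda>x. u x - \<alpha> * ln (norm x)) \<in> O[at_infinity](\<lambda>_. 1)"
      by (rule bump_density.bounded_if_exponent_eq[OF d pos(3)])
    obtain c n0 where core: "0 < c" "\<And>n y. n0 \<le> n \<Longrightarrow> y \<in> ball (bump_center n) (bump_radius q n / 2) \<Longrightarrow>
      c / (bump_radius q n)\<^sup>2 * real n powr (- (l - 2 * \<alpha>)) \<le> - K\<^sub>0 \<eta>\<^sub>0 l q y * exp (2 * u y)"
      using density_core_lower_bound[OF less_imp_le[OF pos(1)] bigo] by blast
    show "\<not> (\<exists>c. ((\<lambda>x. u x - \<alpha> * ln (norm x)) \<longlongrightarrow> c) at_infinity)"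
      using bump_density.not_convergent_if_exponent_eq[OF d pos(3) core] by blast
  next
    fix \<alpha> u
    assume \<alpha>: "(l - q) / 2 < \<alpha>" "\<alpha> < (l - 1) / 2" and u: "cheng_lin_solution (K\<^sub>0 \<eta>\<^sub>0 l q) \<alpha> u"
    have pos: "0 < \<alpha>" "1 < l - 2 * \<alpha>" "l - 2 * \<alpha> < q" using \<alpha> assms(1,2) by (auto simp: field_simps)
    obtain G A where d: "bump_density (\<lambda>t. \<eta>\<^sub>0 (t *\<^sub>R axis 1 1)) u (\<lambda>x. -
        K\<^sub>0 \<eta>\<^sub>0 l q x * exp (2 * u x)) \<alpha> G q (l - 2 * \<alpha>) A"
      by (rule bump_density_of_cheng_lin[OF profile assms(3) u pos(1,2)])
    show "(\<lambda>x. u x - \<alpha> * ln (norm x)) \<notin> O[at_infinity](\<lambda>_. 1)"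
    proof
      assume bigo: "(\<lambda>x. u x - \<alpha> * ln (norm x)) \<in> O[at_infinity](\<lambda>_. 1)"
      obtain c n0 where core: "0 < c" "\<And>n y. n0 \<le> n \<Longrightarrow>
          y \<in> ball (bump_center n) (bump_radius q n / 2) \<Longrightarrow>
        c / (bump_radius q n)\<^sup>2 * real n powr (- (l - 2 * \<alpha>)) \<le> - K\<^sub>0 \<eta>\<^sub>0 l q y * exp (2 * u y)"
        using density_core_lower_bound[OF less_imp_le[OF pos(1)] bigo] by blast
      from bump_density.unbounded_if_exponent_greater[OF d pos(3) core] bigo show False by blast
    qed
  }
qed

end
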